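(* Let $Q$ be the $q$-matrix on $\mathbf Z_+^n$ described in the context (resurrection rates equal to immigration rates). Suppose that $G(1,\dots,1)$ is positively regular, $\{B_i(u_1,\dots,u_n);i=1,\dots,n\}$ is nonsingular, $B_{ij}(1,\dots,1)<\infty$ for all $i,j$, and $\mathbf Z_+^n$ is a communicating class. Let $\lambda_Z$ be the decay parameter on $\mathbf Z_+^n$ of the Feller minimal $Q$-function. Then $$\lambda_Z=-A(q_1,\dots,q_n),$$ where $(q_1,\dots,q_n)$ is the minimal nonnegative solution in $[0,1]^n$ of $B_1(u)=\dots=B_n(u)=0$.
   Context: Fix $n\ge1$; $\mathbf e_k$ is the $k$-th unit vector and $\chi$ the indicator function of $\mathbf Z_+^n$. The $q$-matrix is $$q_{\mathbf{ij}}=\sum_{k=1}^n i_k b^{(k)}_{\mathbf j-\mathbf i+\mathbf e_k}\chi(\mathbf j-\mathbf i+\mathbf e_k)+a_{\mathbf j-\mathbf i}\chi(\mathbf j-\mathbf i),\qquad \mathbf i,\mathbf j\in\mathbf Z_+^n,$$ with $a_{\mathbf j}\ge0$ $(\mathbf j\ne\mathbf 0)$, $0<\sum_{\mathbf j\ne\mathbf 0}a_{\mathbf j}\le-a_{\mathbf 0}<\infty$, and for each $k$: $b^{(k)}_{\mathbf j}\ge0$ $(\mathbf j\ne\mathbf e_k)$, $0<\sum_{\mathbf j\ne\mathbf e_k}b^{(k)}_{\mathbf j}\le-b^{(k)}_{\mathbf e_k}<\infty$. On $[0,1]^n$: $A(u)=\sum_{\mathbf j}a_{\mathbf j}u_1^{j_1}\cdots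 u_n^{j_n}$, $B_k(u)=\sum_{\mathbf j}b^{(k)}_{\mathbf j}u_1^{j_1}\cdots u_n^{j_n}$, $B_{ij}=\partial B_i/\partial u_j$, $g_{ij}=\delta_{ij}-B_{ij}/b^{(i)}_{\mathbf e_i}$, $G=(g_{ij})$. $\{B_i\}$ is nonsingular if there is no $n\times n$ matrix $M$ with $(B_1(u),\dots,B_n(u))^{T}=M(u_1,\dots,u_n)^{T}$ for all $u$. A nonnegative matrix is positively regular if some power of it has all entries strictly positive. Decay parameter: for a transition function $P(t)$ and an irreducible (communicating) class $C$, $\lambda_C\ge 0$ is the number with $\frac1t\log p_{\mathbf{ij}}(t)\to-\lambda_C$ as $t\to\infty$ for all $\mathbf i,\mathbf j\in C$; equivalently $\lambda_C=\sup\{\lambda\ge0:\int_0^\infty e^{\lambda t}p_{\mathbf{ij}}(t)dt<\infty\}=\inf\{\lambda\ge0:\int_0^\infty e^{\lambda t}p_{\mathbf{ij}}(t)dt=\infty\}$, independent of $\mathbf i,\mathbf j\in C$. $\lambda_Z$ is this number for $C=\mathbf Z_+^n$. *)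

theory Defs
  imports "HOL-Analysis.Analysis"
begin

section \<open>The \<open>q\<close>-matrix\<close>

text \<open>
  States are elements of \<open>nat ^ 'n\<close>, where the finite type \<open>'n\<close> indexes the coordinates, and
  \<^term>\<open>axis k 1\<close> is the \<open>k\<close>-th unit vector.  Vectors of naturals are subtracted with
  truncation, so \<open>\<chi>(j - i + e\<^sub>k)\<close> is rendered by the guard \<open>i \<le> j + axis k 1\<close>; under the
  guard the subtraction is exact.
\<close>

definition qmat ::
    "(nat ^ 'n \<Rightarrow> real) \<Rightarrow> ('n \<Rightarrow> nat ^ 'n \<Rightarrow> real) \<Rightarrow> nat ^ 'n \<Rightarrow> nat ^ 'n \<Rightarrow> real" where
  "qmat a b i j =
     (\<Sum>k\<in>UNIV. real (i $ k) * (if i \<le> j + axis k 1 then b k (j + axis k 1 - i) else 0))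
     + (if i \<le> j then a (j - i) else 0)"


section \<open>Generating functions\<close>

definition genfun :: "(nat ^ 'n \<Rightarrow> real) \<Rightarrow> real ^ 'n \<Rightarrow> real" where
  "genfun c u = (\<Sum>\<^sub>\<infinity>j. c j * (\<Prod>l\<in>UNIV. (u $ l) ^ (j $ l)))"

definition coord_upd :: "real ^ 'n \<Rightarrow> 'n \<Rightarrow> real \<Rightarrow> real ^ 'n" where
  "coord_upd u j x = (\<chi> l. if l = j then x else u $ l)"

text \<open>
  Partial derivatives of functions on the cube \<open>[0,1]\<^sup>n\<close>; at a coordinate equal to \<open>0\<close> or \<open>1\<close>
  they are one-sided.  For the functions \<open>B\<^sub>i\<close> the left difference quotients at \<open>1\<close> always
  converge in \<open>(-\<infinity>, \<infinity>]\<close> (only the coefficient at \<open>e\<^sub>i\<close> can be negative), so that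
  \<open>B\<^sub>i\<^sub>j(1,\<dots>,1) < \<infinity>\<close> means precisely that the partial derivative exists.
\<close>

definition has_partial :: "(real ^ 'n \<Rightarrow> real) \<Rightarrow> 'n \<Rightarrow> real ^ 'n \<Rightarrow> bool" where
  "has_partial f j u \<longleftrightarrow> (\<lambda>x. f (coord_upd u j x)) differentiable (at (u $ j) within {0..1})"

definition partial :: "(real ^ 'n \<Rightarrow> real) \<Rightarrow> 'n \<Rightarrow> real ^ 'n \<Rightarrow> real" where
  "partial f j u = vector_derivative (\<lambda>x. f (coord_upd u j x)) (at (u $ j) within {0..1})"

definition G_matrix :: "('n \<Rightarrow> nat ^ 'n \<Rightarrow> real) \<Rightarrow> real ^ 'n \<Rightarrow> real ^ 'n ^ 'n" where
  "G_matrix b u =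
     (\<chi> i j. (if i = j then 1 else 0) - partial (genfun (b i)) j u / b i (axis i 1))"

text \<open>The order on \<open>real ^ 'n\<close> is componentwise, so \<open>{0..1}\<close> is the cube \<open>[0,1]\<^sup>n\<close>.\<close>

definition nonsingular_family :: "('n \<Rightarrow> real ^ 'n \<Rightarrow> real) \<Rightarrow> bool" where
  "nonsingular_family B \<longleftrightarrow>
     \<not> (\<exists>M :: real ^ 'n ^ 'n. \<forall>u\<in>{0..1}. (\<chi> i. B i u) = M *v u)"

definition minimal_root :: "('n \<Rightarrow> real ^ 'n \<Rightarrow> real) \<Rightarrow> real ^ 'n \<Rightarrow> bool" where
  "minimal_root B q \<longleftrightarrow>
     q \<in> {0..1} \<and> (\<forall>k. B k q = 0) \<and> (\<forall>v\<in>{0..1}. (\<forall>k. B k v = 0) \<longrightarrow> q \<le> v)"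

text \<open>
  The operator \<open>^\<close> on \<open>real ^ 'n ^ 'n\<close> would be taken entrywise, so powers are iterated matrix
  products; the exponent \<open>0\<close> is excluded, since the identity matrix is strictly positive
  for \<open>n = 1\<close>.
\<close>

definition positively_regular :: "real ^ 'n ^ 'n \<Rightarrow> bool" where
  "positively_regular M \<longleftrightarrow>
     (\<forall>i j. 0 \<le> M $ i $ j) \<and>
     (\<exists>m\<ge>1. \<forall>i j. 0 < (((**) M ^^ m) (mat 1)) $ i $ j)"


section \<open>The Feller minimal \<open>Q\<close>-function\<close>

text \<open>
  Feller's construction: iterating the integrated backward equation from \<open>0\<close> gives an increasing
  sequence of functions (the \<open>m\<close>-th one being the probability of going from \<open>i\<close> to \<open>j\<close> in
  time \<open>t\<close> with fewer than \<open>m\<close> jumps), whose limit is the minimal nonnegative solution.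
  The arguments of \<^term>\<open>ennreal\<close> are nonnegative as the off-diagonal rates are.
\<close>

primrec feller_iter :: "('s \<Rightarrow> 's \<Rightarrow> real) \<Rightarrow> nat \<Rightarrow> 's \<Rightarrow> 's \<Rightarrow> real \<Rightarrow> ennreal" where
  "feller_iter Q 0 i j t = 0"
| "feller_iter Q (Suc m) i j t =
     (if i = j then ennreal (exp (Q i i * t)) else 0)
     + (\<integral>\<^sup>+ s\<in>{0..t}. ennreal (exp (Q i i * s)) *
          (\<integral>\<^sup>+ k. ennreal (Q i k) * feller_iter Q m k j (t - s) \<partial>count_space (- {i})) \<partial>lborel)"

definition feller_minimal :: "('s \<Rightarrow> 's \<Rightarrow> real) \<Rightarrow> 's \<Rightarrow> 's \<Rightarrow> real \<Rightarrow> real" where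
  "feller_minimal Q i j t = enn2real (SUP m. feller_iter Q m i j t)"


section \<open>Communicating classes and the decay parameter\<close>

definition leads_to :: "('s \<Rightarrow> 's \<Rightarrow> real \<Rightarrow> real) \<Rightarrow> 's \<Rightarrow> 's \<Rightarrow> bool" where
  "leads_to P i j \<longleftrightarrow> (\<exists>t>0. 0 < P i j t)"

definition communicating_class :: "('s \<Rightarrow> 's \<Rightarrow> real \<Rightarrow> real) \<Rightarrow> 's set \<Rightarrow> bool" where
  "communicating_class P C \<longleftrightarrow> (\<exists>i. C = {j. leads_to P i j \<and> leads_to P j i})"

definition is_decay_parameter :: "('s \<Rightarrow> 's \<Rightarrow> real \<Rightarrow> real) \<Rightarrow> 's set \<Rightarrow> real \<Rightarrow> bool" where
  "is_decay_parameter P C \<rho> \<longleftrightarrow>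
     0 \<le> \<rho> \<and> (\<forall>i\<in>C. \<forall>j\<in>C. ((\<lambda>t. ln (P i j t) / t) \<longlongrightarrow> - \<rho>) at_top)"

end

theory Submission
  imports Defs
begin

text \<open>
  Write \<open>u\<^sup>i\<close> for the monomial with exponent vector \<open>i\<close>.  The generator maps \<open>i \<mapsto> u\<^sup>i\<close> to
  \<open>A(u) u\<^sup>i + \<Sum>\<^sub>k i\<^sub>k B\<^sub>k(u) u\<^bsup>i - e\<^sub>k\<^esup>\<close>.  Since \<open>B(q) = 0\<close>, the function \<open>exp (A(q) t) q\<^sup>i\<close> solves the
  backward equation and dominates the minimal solution, so \<open>p\<^sub>0\<^sub>0(t) \<le> exp (A(q) t)\<close>.
  For a lower bound, \<open>exp (A(u) t) u\<^sup>i\<close> is a subsolution vanishing at infinity whenever \<open>B(u) \<ge> 0\<close> and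
  all \<open>u\<^sub>l < 1\<close>; by a maximum principle it can be used once \<open>p\<^sub>i\<^sub>0(T) \<ge> c u\<^sup>i\<close> for some \<open>T\<close> and all \<open>i\<close>.
  Such \<open>u\<close> are reached from \<open>u = 0\<close>, \<open>T = 0\<close> by Euler steps \<open>u \<mapsto> u + \<delta> B(u)\<close>, which increase to
  a root of \<open>B\<close>, hence to a point above \<open>q\<close>.  The Chapman-Kolmogorov inequality and irreducibility
  carry the rate from \<open>p\<^sub>0\<^sub>0\<close> to all \<open>p\<^sub>i\<^sub>j\<close>.
\<close>


section \<open>Comparison principles for Feller's minimal solution\<close>

definition jump_rate :: "('s \<Rightarrow> 's \<Rightarrow> real) \<Rightarrow> ('s \<Rightarrow> ennreal) \<Rightarrow> 's \<Rightarrow> ennreal" where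
  "jump_rate Q f i = (\<integral>\<^sup>+ k. ennreal (Q i k) * f k \<partial>count_space (- {i}))"

text \<open>Conditioning on the first jump: \<open>s\<close> is the holding time in
  \<open>i\<close>, and \<open>t - s\<close> is the time left. With values in \<open>ennreal\<close>
  all sums and integrals exist without side conditions.\<close>

definition renewal :: "('s \<Rightarrow> 's \<Rightarrow> real) \<Rightarrow> ('s \<Rightarrow> real \<Rightarrow> ennreal) \<Rightarrow> 's \<Rightarrow> real \<Rightarrow> ennreal" where
  "renewal Q f i t = (\<integral>\<^sup>+ s\<in>{0..t}. ennreal (exp (Q i i * s)) * jump_rate Q (\<lambda>k. f k (t - s)) i \<partial>lborel)"

definition feller_limit :: "('s \<Rightarrow> 's \<Rightarrow> real) \<Rightarrow> 's \<Rightarrow> 's \<Rightarrow> real \<Rightarrow> ennreal" where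
  "feller_limit Q i j t = (SUP m. feller_iter Q m i j t)"

lemma feller_iter_Suc:
  "feller_iter Q (Suc m) i j t =
     (if i = j then ennreal (exp (Q i i * t)) else 0) + renewal Q (\<lambda>k. feller_iter Q m k j) i t"
  by (simp add: renewal_def jump_rate_def)

declare feller_iter.simps(2) [simp del]

lemma jump_rate_mono: "(\<And>k. f k \<le> g k) \<Longrightarrow> jump_rate Q f i \<le> jump_rate Q g i"
  unfolding jump_rate_def by (intro nn_integral_mono mult_left_mono) auto

lemma jump_rate_cmult: "jump_rate Q (\<lambda>k. c * f k) i = c * jump_rate Q f i"
  unfolding jump_rate_def by (subst nn_integral_cmult [symmetric]) (auto simp: ac_simps)

lemma jump_rate_add: "jump_rate Q (\<lambda>k. f k + g k) i = jump_rate Q f i + jump_rate Q g i"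
  unfolding jump_rate_def by (subst nn_integral_add [symmetric]) (auto simp: algebra_simps)

lemma jump_rate_SUP:
  assumes "\<And>k. incseq (\<lambda>m. f m k)"
  shows "jump_rate Q (\<lambda>k. SUP m. f m k) i = (SUP m. jump_rate Q (f m) i)"
proof -
  have "jump_rate Q (\<lambda>k. SUP m. f m k) i =
      (\<integral>\<^sup>+ k. (SUP m. ennreal (Q i k) * f m k) \<partial>count_space (- {i}))"
    unfolding jump_rate_def by (simp add: SUP_mult_left_ennreal)
  also have "\<dots> = (SUP m. jump_rate Q (f m) i)"
    unfolding jump_rate_def using assms
    by (intro nn_integral_monotone_convergence_SUP)
       (auto simp: incseq_def le_fun_def intro!: mult_left_mono)
  finally show ?thesis .
qed

text \<open>Countability of the states makes the counting measure sigma-finite and turns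
  measurability for each fixed state into joint measurability.\<close>

lemma measurable_jump_rate [measurable]:
  fixes Q :: "'s::countable \<Rightarrow> 's \<Rightarrow> real"
  assumes [measurable]: "\<And>k. (\<lambda>x. f x k) \<in> borel_measurable M"
  shows "(\<lambda>x. jump_rate Q (f x) i) \<in> borel_measurable M"
proof -
  interpret sigma_finite_measure "count_space (- {i})"
    by (rule sigma_finite_measure_count_space_countable) simp
  have "(\<lambda>z. ennreal (Q i (fst z)) * f (snd z) (fst z))
      \<in> borel_measurable (count_space (- {i}) \<Otimes>\<^sub>M M)"
    by (rule measurable_pair_measure_countable1) auto
  from measurable_pair_swap [OF this] show ?thesis
    unfolding jump_rate_def by (intro borel_measurable_nn_integral) simp
qed

lemma renewal_mono:
  assumes "\<And>k s. 0 \<le> s \<Longrightarrow> s \<le> t \<Longrightarrow> f k s \<le> g k s"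
  shows "renewal Q f i t \<le> renewal Q g i t"
  unfolding renewal_def
  by (intro nn_integral_mono)
     (auto split: split_indicator intro!: mult_left_mono jump_rate_mono assms)

lemma renewal_cmult:
  fixes Q :: "'s::countable \<Rightarrow> 's \<Rightarrow> real"
  assumes [measurable]: "\<And>k. f k \<in> borel_measurable borel"
  shows "renewal Q (\<lambda>k t. c * f k t) i t = c * renewal Q f i t"
  unfolding renewal_def
  by (subst nn_integral_cmult [symmetric]) (simp_all add: jump_rate_cmult ac_simps)

lemma measurable_renewal:
  fixes Q :: "'s::countable \<Rightarrow> 's \<Rightarrow> real"
  assumes [measurable]: "\<And>k. f k \<in> borel_measurable borel"
  shows "renewal Q f i \<in> borel_measurable borel"
proof -
  \<comment> \<open>The domain of integration depends on \<open>t\<close>; as an explicit condition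
    it becomes part of an integrand that is jointly measurable in \<open>s\<close> and
    \<open>t\<close>.\<close>
  have *: "renewal Q f i t = (\<integral>\<^sup>+ s. ennreal (exp (Q i i * s)) * jump_rate Q (\<lambda>k. f k (t - s)) i
      * (if 0 \<le> s \<and> s \<le> t then 1 else 0) \<partial>lborel)" for t
    unfolding renewal_def by (intro nn_integral_cong) (auto split: split_indicator)
  have "(\<lambda>t. renewal Q f i t) \<in> borel_measurable borel"
    unfolding * by measurable
  then show ?thesis .
qed

text \<open>Monotone convergence is used twice, for the sum over states and for the time
  integral.\<close>

lemma renewal_SUP:
  fixes Q :: "'s::countable \<Rightarrow> 's \<Rightarrow> real"
  assumes inc: "\<And>k t. incseq (\<lambda>m. f m k t)"
    and [measurable]: "\<And>m k. f m k \<in> borel_measurable borel"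
  shows "renewal Q (\<lambda>k t. SUP m. f m k t) i t = (SUP m. renewal Q (f m) i t)"
proof -
  have "renewal Q (\<lambda>k t. SUP m. f m k t) i t = (\<integral>\<^sup>+ s. (SUP m. ennreal (exp (Q i i * s)) *
      jump_rate Q (\<lambda>k. f m k (t - s)) i * indicator {0..t} s) \<partial>lborel)"
    unfolding renewal_def
    by (subst jump_rate_SUP) (simp_all add: inc SUP_mult_left_ennreal SUP_mult_right_ennreal)
  also have "\<dots> = (SUP m. renewal Q (f m) i t)"
    unfolding renewal_def
  proof (intro nn_integral_monotone_convergence_SUP)
    show "incseq (\<lambda>m s. ennreal (exp (Q i i * s)) *
      jump_rate Q (\<lambda>k. f m k (t - s)) i * indicator {0..t} s)"
      using inc unfolding incseq_def le_fun_def
      by (auto intro!: mult_right_mono mult_left_mono jump_rate_mono)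
  qed measurable
  finally show ?thesis .
qed

lemma measurable_feller_iter [measurable]:
  fixes Q :: "'s::countable \<Rightarrow> 's \<Rightarrow> real"
  shows "feller_iter Q m i j \<in> borel_measurable borel"
proof (induction m arbitrary: i)
  case 0
  have "feller_iter Q 0 i j = (\<lambda>t. 0)" by auto
  then show ?case by simp
next
  case (Suc m)
  have [measurable]: "renewal Q (\<lambda>k. feller_iter Q m k j) i \<in> borel_measurable borel"
    using Suc by (rule measurable_renewal)
  have "feller_iter Q (Suc m) i j = (\<lambda>t. (if i = j then ennreal (exp (Q i i * t)) else 0)
      + renewal Q (\<lambda>k. feller_iter Q m k j) i t)"
    by (simp add: feller_iter_Suc fun_eq_iff)
  then show ?case by simp
qed

lemma incseq_feller_iter: "incseq (\<lambda>m. feller_iter Q m i j t)"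
proof (rule incseq_SucI)
  fix m
  show "feller_iter Q m i j t \<le> feller_iter Q (Suc m) i j t"
  proof (induction m arbitrary: i t)
    case (Suc m)
    then show ?case
      unfolding feller_iter_Suc [of Q "Suc m"] feller_iter_Suc [of Q m]
      by (intro add_left_mono renewal_mono)
  qed simp
qed

lemma measurable_feller_limit [measurable]:
  fixes Q :: "'s::countable \<Rightarrow> 's \<Rightarrow> real"
  shows "feller_limit Q i j \<in> borel_measurable borel"
  unfolding feller_limit_def [abs_def] by measurable

text \<open>The limit is a fixed point of the iteration, because \<open>renewal\<close> commutes
  with increasing suprema.\<close>

lemma feller_limit_renewal:
  fixes Q :: "'s::countable \<Rightarrow> 's \<Rightarrow> real"
  shows "feller_limit Q i j t =
    (if i = j then ennreal (exp (Q i i * t)) else 0) + renewal Q (\<lambda>k. feller_limit Q k j) i t"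
proof -
  have "feller_limit Q i j t = (SUP m. feller_iter Q (Suc m) i j t)"
  proof -
    have "feller_iter Q m i j t \<le> feller_iter Q (Suc m) i j t" for m
      by (rule incseq_SucD [OF incseq_feller_iter])
    then show ?thesis
      unfolding feller_limit_def by (intro antisym SUP_mono) blast+
  qed
  also have "\<dots> = (if i = j then ennreal (exp (Q i i * t)) else 0)
      + (SUP m. renewal Q (\<lambda>k. feller_iter Q m k j) i t)"
    unfolding feller_iter_Suc by (rule ennreal_SUP_add_right [symmetric]) simp
  also have "(SUP m. renewal Q (\<lambda>k. feller_iter Q m k j) i t) = renewal Q (\<lambda>k. feller_limit Q k j) i t"
    unfolding feller_limit_def by (rule renewal_SUP [symmetric]) (simp_all add: incseq_feller_iter)
  finally show ?thesis .
qed

section \<open>Time shifts and the Chapman-Kolmogorov inequality\<close>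

text \<open>The renewal integral over \<open>{0..T+t}\<close> is split at holding time
  \<open>t\<close>. Longer holding times carry the factor \<open>exp (Q i i * t)\<close> and form
  the first summand; the others form the second.\<close>

lemma feller_limit_shift:
  fixes Q :: "'s::countable \<Rightarrow> 's \<Rightarrow> real"
  assumes "0 \<le> T" "0 \<le> t"
  shows "ennreal (exp (Q i i * t)) * feller_limit Q i j T
      + renewal Q (\<lambda>k s. feller_limit Q k j (T + s)) i t \<le> feller_limit Q i j (T + t)"
proof -
  define g where "g s = jump_rate Q (\<lambda>k. feller_limit Q k j s) i" for s
  have [measurable]: "g \<in> borel_measurable borel" unfolding g_def by measurable
  define d where "d t = (if i = j then ennreal (exp (Q i i * t)) else 0)" for t
  have L: "feller_limit Q i j t = d t + (\<integral>\<^sup>+ s\<in>{0..t}. ennreal (exp (Q i i * s)) * g (t - s) \<partial>lborel)" for t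
    unfolding d_def g_def by (subst feller_limit_renewal) (simp add: renewal_def)
  have "ennreal (exp (Q i i * t)) * (\<integral>\<^sup>+ s\<in>{0..T}. ennreal (exp (Q i i * s)) * g (T - s) \<partial>lborel)
    = (\<integral>\<^sup>+ s. ennreal (exp (Q i i * (t + s))) * g (T - s) * indicator {0..T} s \<partial>lborel)"
    by (subst nn_integral_cmult [symmetric])
       (auto intro!: nn_integral_cong simp: ac_simps exp_add ring_distribs ennreal_mult)
  also have "\<dots> = (\<integral>\<^sup>+ s. ennreal (exp (Q i i * s)) * g (T + t - s) * indicator {t..T+t} s \<partial>lborel)"
    by (subst (2) nn_integral_real_affine [where c = 1 and t = t])
       (auto intro!: nn_integral_cong split: split_indicator)
  \<comment> \<open>Removing the null set \<open>{t}\<close> makes the two domains of integration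
    disjoint.\<close>
  also have "\<dots> = (\<integral>\<^sup>+ s. ennreal (exp (Q i i * s)) * g (T + t - s) * indicator {t<..T+t} s \<partial>lborel)"
  proof (rule nn_integral_cong_AE)
    show "AE s in lborel. ennreal (exp (Q i i * s)) * g (T + t - s) * indicator {t..T+t} s
        = ennreal (exp (Q i i * s)) * g (T + t - s) * indicator {t<..T+t} s"
      using AE_lborel_singleton [of t] by eventually_elim (simp add: indicator_def)
  qed
  finally have 1: "ennreal (exp (Q i i * t)) * (\<integral>\<^sup>+ s\<in>{0..T}. ennreal (exp (Q i i * s)) * g (T - s) \<partial>lborel)
    = (\<integral>\<^sup>+ s\<in>{t<..T+t}. ennreal (exp (Q i i * s)) * g (T + t - s) \<partial>lborel)" .
  have 2: "renewal Q (\<lambda>k s. feller_limit Q k j (T + s)) i t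
    = (\<integral>\<^sup>+ s\<in>{0..t}. ennreal (exp (Q i i * s)) * g (T + t - s) \<partial>lborel)"
    unfolding renewal_def g_def by (simp add: algebra_simps)
  have "(\<integral>\<^sup>+ s\<in>{0..T+t}. ennreal (exp (Q i i * s)) * g (T + t - s) \<partial>lborel)
    = (\<integral>\<^sup>+ s\<in>{t<..T+t}. ennreal (exp (Q i i * s)) * g (T + t - s) \<partial>lborel)
      + (\<integral>\<^sup>+ s\<in>{0..t}. ennreal (exp (Q i i * s)) * g (T + t - s) \<partial>lborel)"
    using assms by (subst nn_integral_add [symmetric])
       (auto intro!: nn_integral_cong split: split_indicator)
  moreover have "ennreal (exp (Q i i * t)) * d T = d (T + t)"
    by (auto simp: d_def exp_add [symmetric] ennreal_mult' [symmetric] algebra_simps)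
  ultimately show ?thesis
    by (subst (1 2) L) (simp add: distrib_left 1 2 add.assoc)
qed

text \<open>Induction on the iterates in the first factor, with the second factor \<open>c\<close>
  held fixed: \<open>renewal\<close> takes off the first jump, and \<open>feller_limit_shift\<close>
  puts it back in front of the longer path.\<close>

lemma feller_limit_chapman_kolmogorov:
  fixes Q :: "'s::countable \<Rightarrow> 's \<Rightarrow> real"
  assumes "0 \<le> s" "0 \<le> t"
  shows "feller_limit Q i k s * feller_limit Q k j t \<le> feller_limit Q i j (s + t)"
proof -
  define c where "c = feller_limit Q k j t"
  have "c * feller_iter Q m i k s \<le> feller_limit Q i j (t + s)" if "0 \<le> s" for m i s
    using that
  proof (induction m arbitrary: i s)
    case (Suc m)
    have "c * feller_iter Q (Suc m) i k s =
        (if i = k then ennreal (exp (Q i i * s)) * feller_limit Q i j t else 0)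
        + renewal Q (\<lambda>l s. c * feller_iter Q m l k s) i s"
      by (subst renewal_cmult) (auto simp: feller_iter_Suc distrib_left c_def mult.commute)
    also have "\<dots> \<le> ennreal (exp (Q i i * s)) * feller_limit Q i j t
        + renewal Q (\<lambda>l s. feller_limit Q l j (t + s)) i s"
      by (intro add_mono renewal_mono Suc.IH) auto
    also have "\<dots> \<le> feller_limit Q i j (t + s)"
      using assms Suc.prems by (intro feller_limit_shift)
    finally show ?case .
  qed simp
  from this [OF assms(1)] show ?thesis
    unfolding c_def feller_limit_def [of Q i k]
    by (subst SUP_mult_right_ennreal) (auto intro!: SUP_least simp: ac_simps)
qed

section \<open>Supersolutions and subsolutions of the backward equation\<close>

text \<open>Variation of constants: the integrand is the derivative of
  \<open>- exp (c * s) * U (t - s)\<close> with respect to \<open>s\<close>, and its sign permits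
  the fundamental theorem for nonnegative integrals.\<close>

lemma nn_integral_duhamel:
  fixes U U' :: "real \<Rightarrow> real"
  assumes "0 \<le> t"
    and [measurable]: "U \<in> borel_measurable borel" "U' \<in> borel_measurable borel"
    and deriv: "\<And>s. s \<in> {0..t} \<Longrightarrow> (U has_real_derivative U' s) (at s)"
    and nonneg: "\<And>s. s \<in> {0..t} \<Longrightarrow> 0 \<le> U' s - c * U s"
  shows "(\<integral>\<^sup>+ s\<in>{0..t}. ennreal (exp (c * s)) * ennreal (U' (t - s) - c * U (t - s)) \<partial>lborel)
    = ennreal (U t - exp (c * t) * U 0)"
proof -
  define F where "F s = - (exp (c * s) * U (t - s))" for s
  have "(\<integral>\<^sup>+ s. ennreal (exp (c * s) * (U' (t - s) - c * U (t - s))) * indicator {0..t} s \<partial>lborel)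
      = ennreal (F t - F 0)"
  proof (rule nn_integral_FTC_Icc)
    fix s assume s: "s \<in> {0..t}"
    have "((\<lambda>s. t - s) has_real_derivative - 1) (at s)"
      by (auto intro!: derivative_eq_intros)
    from DERIV_chain' [OF this deriv [of "t - s"]] s
    have "((\<lambda>s. U (t - s)) has_real_derivative - U' (t - s)) (at s)"
      by simp
    then show "(F has_real_derivative exp (c * s) * (U' (t - s) - c * U (t - s))) (at s)"
      unfolding F_def by (auto intro!: derivative_eq_intros simp: algebra_simps)
    show "0 \<le> exp (c * s) * (U' (t - s) - c * U (t - s))"
      using nonneg [of "t - s"] s by simp
  qed (use assms(1) in auto)
  then show ?thesis
    by (simp add: F_def ennreal_mult')
qed

text \<open>Every iterate stays below \<open>U t = f i * exp (c * t)\<close>: the renewal term is at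
  most \<open>U t - exp (Q i i * t) * U 0\<close>, and \<open>1 \<le> f j\<close> lets the missing
  part absorb the term without jumps.\<close>

lemma feller_limit_le_supersolution:
  fixes Q :: "'s::countable \<Rightarrow> 's \<Rightarrow> real"
  assumes f: "\<And>i. 0 \<le> f i" "1 \<le> f j"
    and diag: "\<And>i. Q i i \<le> c"
    and super: "\<And>i. jump_rate Q (\<lambda>k. ennreal (f k)) i \<le> ennreal ((c - Q i i) * f i)"
    and "0 \<le> t"
  shows "feller_limit Q i j t \<le> ennreal (f i * exp (c * t))"
proof -
  have "feller_iter Q m i j t \<le> ennreal (f i * exp (c * t))" if "0 \<le> t" for m t
    using that
  proof (induction m arbitrary: i t)
    case (Suc m)
    define U where "U s = f i * exp (c * s)" for s
    have "renewal Q (\<lambda>k. feller_iter Q m k j) i t \<le> renewal Q (\<lambda>k s. ennreal (f k * exp (c * s))) i t"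
      by (intro renewal_mono Suc.IH)
    also have "\<dots> \<le> (\<integral>\<^sup>+ s\<in>{0..t}. ennreal (exp (Q i i * s)) *
        ennreal (c * U (t - s) - Q i i * U (t - s)) \<partial>lborel)"
      unfolding renewal_def
    proof (intro nn_integral_mono mult_right_mono mult_left_mono)
      fix s
      have "jump_rate Q (\<lambda>k. ennreal (f k * exp (c * (t - s)))) i
          = ennreal (exp (c * (t - s))) * jump_rate Q (\<lambda>k. ennreal (f k)) i"
        by (subst jump_rate_cmult [symmetric]) (simp add: f ennreal_mult' mult.commute)
      also have "\<dots> \<le> ennreal (exp (c * (t - s))) * ennreal ((c - Q i i) * f i)"
        by (intro mult_left_mono super) auto
      also have "\<dots> = ennreal (c * U (t - s) - Q i i * U (t - s))"
        by (simp add: ennreal_mult' [symmetric] U_def algebra_simps)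
      finally show "jump_rate Q (\<lambda>k. ennreal (f k * exp (c * (t - s)))) i
          \<le> ennreal (c * U (t - s) - Q i i * U (t - s))" .
    qed auto
    also have "\<dots> = ennreal (U t - exp (Q i i * t) * U 0)"
    proof (rule nn_integral_duhamel)
      fix s
      have "c * U s - Q i i * U s = (c - Q i i) * U s" by (simp add: algebra_simps)
      also have "0 \<le> \<dots>" using f(1) [of i] diag [of i] by (simp add: U_def)
      finally show "0 \<le> c * U s - Q i i * U s" .
    qed (use Suc.prems in \<open>auto simp: U_def [abs_def] intro!: derivative_eq_intros\<close>)
    finally have *: "renewal Q (\<lambda>k. feller_iter Q m k j) i t \<le> ennreal (U t - exp (Q i i * t) * f i)"
      by (simp add: U_def)
    have "feller_iter Q (Suc m) i j t
        \<le> ennreal (exp (Q i i * t) * f i) + ennreal (U t - exp (Q i i * t) * f i)"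
      unfolding feller_iter_Suc by (intro add_mono *) (use f in \<open>auto intro!: ennreal_leI\<close>)
    also have "\<dots> = ennreal (U t)"
    proof (subst ennreal_plus [symmetric])
      have "exp (Q i i * t) * f i \<le> exp (c * t) * f i"
        using f(1) diag Suc.prems by (intro mult_right_mono) (auto intro: mult_right_mono)
      then show "0 \<le> U t - exp (Q i i * t) * f i" by (simp add: U_def mult.commute)
    qed (use f in auto)
    finally show ?case by (simp add: U_def)
  qed simp
  then show ?thesis
    unfolding feller_limit_def using assms by (auto intro: SUP_least)
qed

text \<open>
  Maximum principle: if \<open>U \<le> W + M\<close> then \<open>U \<le> W + max \<epsilon> (\<gamma> M)\<close> with \<open>\<gamma> < 1\<close> depending only on \<open>\<epsilon>\<close>,
  since \<open>Z \<le> \<epsilon>\<close> outside a finite set and \<open>1 - exp (Q i i * T)\<close> is bounded away from \<open>1\<close> on it.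
  Without the domination by \<open>Z\<close> the claim fails when the minimal process explodes.
\<close>

lemma subsolution_le_feller_limit:
  fixes Q :: "'s::countable \<Rightarrow> 's \<Rightarrow> real" and U U' :: "'s \<Rightarrow> real \<Rightarrow> real"
  assumes rows: "\<And>i. jump_rate Q (\<lambda>_. 1) i \<le> ennreal (- Q i i)"
    and diag: "\<And>i. Q i i \<le> 0"
    and T0: "0 \<le> T\<^sub>0"
    and meas [measurable]: "\<And>i. U i \<in> borel_measurable borel" "\<And>i. U' i \<in> borel_measurable borel"
    and deriv: "\<And>i s. s \<in> {0..T} \<Longrightarrow> (U i has_real_derivative U' i s) (at s)"
    and nonneg: "\<And>i s. s \<in> {0..T} \<Longrightarrow> 0 \<le> U i s"
      "\<And>i s. s \<in> {0..T} \<Longrightarrow> 0 \<le> U' i s - Q i i * U i s"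
    and sub: "\<And>i s. s \<in> {0..T} \<Longrightarrow>
      ennreal (U' i s - Q i i * U i s) \<le> jump_rate Q (\<lambda>k. ennreal (U k s)) i"
    and dom: "\<And>i s. s \<in> {0..T} \<Longrightarrow> U i s \<le> Z i"
    and vanish: "\<And>e. 0 < e \<Longrightarrow> finite {i. e < Z i}"
    and init: "\<And>i. ennreal (U i 0) \<le> feller_limit Q i j T\<^sub>0"
    and t: "t \<in> {0..T}"
  shows "ennreal (U i t) \<le> feller_limit Q i j (T\<^sub>0 + t)"
proof -
  let ?W = "\<lambda>i t. feller_limit Q i j (T\<^sub>0 + t)"
  \<comment> \<open>Inserting the bound with excess \<open>M\<close> into the variation of constants
    formula returns it with excess \<open>M * (1 - exp (Q i i * t))\<close>, since the jump rates
    out of \<open>i\<close> sum to at most \<open>- Q i i\<close>.\<close>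
  have step: "ennreal (U i t) \<le> ?W i t + ennreal (M * (1 - exp (Q i i * t)))"
    if M: "0 \<le> M" "\<And>i t. t \<in> {0..T} \<Longrightarrow> ennreal (U i t) \<le> ?W i t + ennreal M" and t: "t \<in> {0..T}"
    for M i t
  proof -
    have "exp (Q i i * t) \<le> 1"
      using diag [of i] t by (simp add: mult_nonpos_nonneg)
    have "ennreal (U i t - exp (Q i i * t) * U i 0)
        = (\<integral>\<^sup>+ s\<in>{0..t}. ennreal (exp (Q i i * s)) *
            ennreal (U' i (t - s) - Q i i * U i (t - s)) \<partial>lborel)"
      using t by (intro nn_integral_duhamel [symmetric] deriv nonneg) auto
    also have "\<dots> \<le> (\<integral>\<^sup>+ s. ennreal (exp (Q i i * s)) *
          jump_rate Q (\<lambda>k. ?W k (t - s)) i * indicator {0..t} s +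
          ennreal (exp (Q i i * s)) * ennreal (0 - Q i i * M) * indicator {0..t} s \<partial>lborel)"
    proof (rule nn_integral_mono)
      fix s
      have "ennreal (U' i (t - s) - Q i i * U i (t - s)) \<le>
          jump_rate Q (\<lambda>k. ?W k (t - s)) i + ennreal (0 - Q i i * M)" if "s \<in> {0..t}"
      proof -
        have "ennreal (U' i (t - s) - Q i i * U i (t - s)) \<le> jump_rate Q (\<lambda>k. ennreal (U k (t - s))) i"
          using that t by (intro sub) auto
        also have "\<dots> \<le> jump_rate Q (\<lambda>k. ?W k (t - s) + ennreal M * 1) i"
          using that t by (intro jump_rate_mono) (auto intro!: M)
        also have "\<dots> \<le> jump_rate Q (\<lambda>k. ?W k (t - s)) i + ennreal M * ennreal (- Q i i)"
          unfolding jump_rate_add jump_rate_cmult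
          by (intro add_left_mono mult_left_mono rows) auto
        also have "ennreal M * ennreal (- Q i i) = ennreal (0 - Q i i * M)"
          using M(1) by (simp add: ennreal_mult' [symmetric] mult.commute)
        finally show ?thesis .
      qed
      then show "ennreal (exp (Q i i * s)) *
            ennreal (U' i (t - s) - Q i i * U i (t - s)) * indicator {0..t} s
          \<le> ennreal (exp (Q i i * s)) * jump_rate Q (\<lambda>k. ?W k (t - s)) i * indicator {0..t} s +
            ennreal (exp (Q i i * s)) * ennreal (0 - Q i i * M) * indicator {0..t} s"
        by (auto split: split_indicator simp: distrib_left [symmetric] intro!: mult_left_mono)
    qed
    also have "\<dots> = renewal Q ?W i t +
        (\<integral>\<^sup>+ s\<in>{0..t}. ennreal (exp (Q i i * s)) * ennreal (0 - Q i i * M) \<partial>lborel)"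
      unfolding renewal_def by (rule nn_integral_add) measurable
    also have "(\<integral>\<^sup>+ s\<in>{0..t}. ennreal (exp (Q i i * s)) * ennreal (0 - Q i i * M) \<partial>lborel)
        = ennreal (M - exp (Q i i * t) * M)"
      using t M(1) diag [of i]
      by (intro nn_integral_duhamel [of t "\<lambda>_. M" "\<lambda>_. 0"]) (auto simp: mult_nonpos_nonneg)
    finally have 1: "ennreal (U i t - exp (Q i i * t) * U i 0)
        \<le> renewal Q ?W i t + ennreal (M - exp (Q i i * t) * M)" .
    have 2: "ennreal (exp (Q i i * t) * U i 0) \<le> ennreal (exp (Q i i * t)) * feller_limit Q i j T\<^sub>0"
      using init [of i] by (simp add: ennreal_mult' mult_left_mono)
    have "ennreal (exp (Q i i * t) * U i 0) + ennreal (U i t - exp (Q i i * t) * U i 0)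
        \<le> (ennreal (exp (Q i i * t)) * feller_limit Q i j T\<^sub>0 + renewal Q ?W i t)
          + ennreal (M - exp (Q i i * t) * M)"
      unfolding add.assoc by (rule add_mono [OF 2 1])
    also have "\<dots> \<le> ?W i t + ennreal (M * (1 - exp (Q i i * t)))"
      using T0 t by (intro add_mono feller_limit_shift) (auto simp: algebra_simps)
    finally have "ennreal (exp (Q i i * t) * U i 0) + ennreal (U i t - exp (Q i i * t) * U i 0)
        \<le> ?W i t + ennreal (M * (1 - exp (Q i i * t)))" .
    \<comment> \<open>\<open>ennreal\<close> sends negative differences to 0, so this inequality
      holds whatever the sign.\<close>
    moreover have "ennreal (U i t)
        \<le> ennreal (exp (Q i i * t) * U i 0) + ennreal (U i t - exp (Q i i * t) * U i 0)"
      using ennreal_plus_if by (auto simp: ennreal_leI ennreal_plus_if)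
    ultimately show ?thesis by (rule order_trans [rotated])
  qed
  show ?thesis
  proof (rule ennreal_le_epsilon)
    fix e :: real assume e: "0 < e"
    \<comment> \<open>\<open>g\<close> is a common contraction factor on the finite set
      \<open>S\<close>, and \<open>K\<close> bounds \<open>Z\<close> globally because only finitely
      many values exceed 1. The inserted elements keep both maxima defined when the sets are
      empty.\<close>
    define S where "S = {i. e < Z i}"
    define g where "g = Max (insert 0 ((\<lambda>i. 1 - exp (Q i i * T)) ` S))"
    define K where "K = Max (insert 1 (Z ` {i. 1 < Z i}))"
    have fin: "finite S" "finite {i. 1 < Z i}"
      using vanish e by (auto simp: S_def)
    have g: "0 \<le> g" "g < 1" "\<And>i. i \<in> S \<Longrightarrow> 1 - exp (Q i i * T) \<le> g"
      using fin unfolding g_def by (auto intro: Max_ge)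
    have K: "1 \<le> K" "\<And>i. Z i \<le> K"
    proof -
      show K1: "1 \<le> K" using fin unfolding K_def by auto
      show "Z i \<le> K" for i
      proof (cases "1 < Z i")
        case True
        then show ?thesis using fin unfolding K_def by (intro Max_ge) auto
      qed (use K1 in linarith)
    qed
    \<comment> \<open>On \<open>S\<close> each round of \<open>step\<close> multiplies the excess by
      at most \<open>g\<close>; off \<open>S\<close> the excess is at most \<open>e\<close> because
      \<open>U\<close> is dominated by \<open>Z\<close>.\<close>
    have "ennreal (U i t) \<le> ?W i t + ennreal (max e (g ^ n * K))" if "t \<in> {0..T}" for n i t
      using that
    proof (induction n arbitrary: i t)
      case 0
      have "U i t \<le> max e K" using dom [OF 0, of i] K(2) [of i] by linarith
      then show ?case by (auto intro!: add_increasing ennreal_leI)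
    next
      case (Suc n)
      let ?M = "max e (g ^ n * K)"
      show ?case
      proof (cases "i \<in> S")
        case True
        have "exp (Q i i * T) \<le> exp (Q i i * t)"
          using Suc.prems diag [of i] by (auto intro: mult_left_mono_neg)
        then have "1 - exp (Q i i * t) \<le> g"
          using g(3) [OF True] by linarith
        then have "?M * (1 - exp (Q i i * t)) \<le> ?M * g"
          using e by (intro mult_left_mono) auto
        also have "\<dots> \<le> max e (g ^ Suc n * K)"
        proof -
          have "e * g \<le> e"
            using g e by (auto intro!: mult_left_le)
          then show ?thesis by (auto simp: max_def mult_ac)
        qed
        finally have "?M * (1 - exp (Q i i * t)) \<le> max e (g ^ Suc n * K)" .
        then show ?thesis
          using e by (intro order_trans [OF step [OF _ Suc.IH Suc.prems]] add_left_mono ennreal_leI) auto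
      next
        case False
        then have "U i t \<le> max e (g ^ Suc n * K)"
          using dom [OF Suc.prems, of i] by (auto simp: S_def)
        then show ?thesis by (auto intro!: add_increasing ennreal_leI)
      qed
    qed
    note bound = this [OF t]
    have "(\<lambda>n. g ^ n * K) \<longlonglongrightarrow> 0 * K"
      using g by (intro tendsto_mult LIMSEQ_realpow_zero tendsto_const) auto
    then have "eventually (\<lambda>n. g ^ n * K < e) sequentially"
      using e by (auto intro: order_tendstoD)
    then obtain n where "g ^ n * K < e"
      by (auto simp: eventually_sequentially)
    with bound [of i n] show "ennreal (U i t) \<le> ?W i t + ennreal e" by (simp add: max_def)
  qed
qed


section \<open>Monomials and generating functions\<close>

text \<open>This keeps \<open>axis k 1\<close> in the form in which the rules for unit vectors are
  stated.\<close>

declare One_nat_def [simp del]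

lemma zero_le_one_vec [simp]: "(0 :: real ^ 'n) \<le> 1"
  by (simp add: less_eq_vec_def)

section \<open>Monomials\<close>

definition vpow :: "real ^ 'n \<Rightarrow> nat ^ 'n \<Rightarrow> real" where
  "vpow u j = (\<Prod>l\<in>UNIV. (u $ l) ^ (j $ l))"

lemma genfun_vpow: "genfun c u = (\<Sum>\<^sub>\<infinity>j. c j * vpow u j)"
  by (simp add: genfun_def vpow_def)

lemma vpow_nonneg: "0 \<le> u \<Longrightarrow> 0 \<le> vpow u j"
  by (auto simp: vpow_def less_eq_vec_def intro: prod_nonneg)

lemma vpow_mono: "0 \<le> u \<Longrightarrow> u \<le> v \<Longrightarrow> vpow u j \<le> vpow v j"
  by (auto simp: vpow_def less_eq_vec_def intro!: prod_mono power_mono)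

lemma vpow_one [simp]: "vpow 1 j = 1"
  by (simp add: vpow_def)

lemma vpow_exp_zero [simp]: "vpow u 0 = 1"
  by (simp add: vpow_def)

lemma vpow_le_one: "u \<in> {0..1} \<Longrightarrow> vpow u j \<le> 1"
  using vpow_mono [of u 1 j] by simp

lemma vpow_add: "vpow u (i + j) = vpow u i * vpow u j"
  by (simp add: vpow_def power_add prod.distrib)

lemma vpow_axis [simp]: "vpow u (axis k 1) = u $ k"
  by (simp add: vpow_def axis_def if_distrib cong: if_cong)

text \<open>With \<open>0 ^ 0 = 1\<close> the monomials at the origin form the indicator of state 0,
  which is the initial value for the target state 0.\<close>

lemma vpow_zero: "vpow 0 i = (if i = 0 then 1 else 0)"
  by (auto simp: vpow_def vec_eq_iff power_0_left)

lemma vpow_le_coord: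
  assumes "u \<in> {0..1}"
  shows "vpow u i \<le> (u $ l) ^ (i $ l)"
proof -
  have "vpow u i = (u $ l) ^ (i $ l) * (\<Prod>m\<in>UNIV - {l}. (u $ m) ^ (i $ m))"
    by (simp add: vpow_def prod.remove [of UNIV l])
  also have "\<dots> \<le> (u $ l) ^ (i $ l)"
    using assms by (intro mult_left_le prod_le_1) (auto simp: less_eq_vec_def power_le_one)
  finally show ?thesis .
qed

lemma vpow_remove:
  fixes i :: "nat ^ 'n"
  assumes "0 < i $ k"
  shows "vpow u (i - axis k 1) = (u $ k) ^ (i $ k - 1) * (\<Prod>l\<in>UNIV - {k}. (u $ l) ^ (i $ l))"
proof -
  have "(\<Prod>l\<in>UNIV - {k}. (u $ l) ^ ((i - axis k 1) $ l)) = (\<Prod>l\<in>UNIV - {k}. (u $ l) ^ (i $ l))"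
    by (intro prod.cong) (auto simp: axis_def)
  then show ?thesis
    by (simp add: vpow_def prod.remove [of UNIV k] axis_def)
qed

lemma has_field_derivative_vpow_line:
  fixes i :: "nat ^ 'n"
  shows "((\<lambda>s. vpow (u + s *\<^sub>R w) i) has_real_derivative
    (\<Sum>k\<in>UNIV. real (i $ k) * w $ k * vpow (u + s *\<^sub>R w) (i - axis k 1))) (at s)"
proof -
  have "((\<lambda>s. \<Prod>l\<in>UNIV. (u $ l + s * w $ l) ^ (i $ l)) has_real_derivative
    (\<Sum>k\<in>UNIV. (real (i $ k) * (u $ k + s * w $ k) ^ (i $ k - 1) * w $ k) *
      (\<Prod>l\<in>UNIV - {k}. (u $ l + s * w $ l) ^ (i $ l)))) (at s)"
    by (rule has_field_derivative_prod) (auto intro!: derivative_eq_intros simp: One_nat_def)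
  \<comment> \<open>For \<open>i $ k = 0\<close> the subtraction \<open>i - axis k 1\<close>
    truncates, but the factor \<open>real (i $ k)\<close> vanishes.\<close>
  moreover have "(real (i $ k) * (u $ k + s * w $ k) ^ (i $ k - 1) * w $ k) *
      (\<Prod>l\<in>UNIV - {k}. (u $ l + s * w $ l) ^ (i $ l))
      = real (i $ k) * w $ k * vpow (u + s *\<^sub>R w) (i - axis k 1)" for k
    by (cases "i $ k = 0") (simp_all add: vpow_remove)
  ultimately show ?thesis
    by (simp add: vpow_def [of _ i])
qed

text \<open>A monomial is at most each single factor \<open>u $ l ^ (i $ l)\<close>, which tends to
  0 in \<open>i $ l\<close>; hence every coordinate of such an \<open>i\<close> stays below a common
  bound.\<close>

lemma finite_vpow_greater:
  fixes u :: "real ^ 'n"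
  assumes u: "0 \<le> u" "\<And>l. u $ l < 1" and e: "0 < e"
  shows "finite {i. e < vpow u i}"
proof -
  have u': "u \<in> {0..1}" using u by (auto simp: less_eq_vec_def less_imp_le)
  have "\<exists>N. u $ l ^ N < e" for l
    using u e by (intro real_arch_pow_inv) auto
  then obtain N where N: "u $ l ^ N l < e" for l by metis
  have N': "i $ l < Max (range N)" if "e < vpow u i" for i l
  proof (rule ccontr)
    assume "\<not> i $ l < Max (range N)"
    moreover have "N l \<le> Max (range N)" by simp
    ultimately have "N l \<le> i $ l" by linarith
    then have "u $ l ^ (i $ l) \<le> u $ l ^ N l"
      using u' by (intro power_decreasing) (auto simp: less_eq_vec_def)
    then show False using vpow_le_coord [OF u', of i l] N [of l] that by linarith
  qed
  have "{i. e < vpow u i} \<subseteq> vec_lambda ` (UNIV \<rightarrow>\<^sub>E {..<Max (range N)})"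
  proof
    fix i assume "i \<in> {i. e < vpow u i}"
    then have "(\<lambda>l. i $ l) \<in> UNIV \<rightarrow>\<^sub>E {..<Max (range N)}"
      using N' by (auto simp: PiE_UNIV_domain)
    then show "i \<in> vec_lambda ` (UNIV \<rightarrow>\<^sub>E {..<Max (range N)})"
      by (rule rev_image_eqI) simp
  qed
  then show ?thesis
    by (rule finite_subset) (intro finite_imageI finite_PiE; simp)
qed

section \<open>Generating functions on the cube and sums over states\<close>

lemma genfun_zero: "genfun c 0 = c 0"
proof -
  have "genfun c 0 = (\<Sum>\<^sub>\<infinity>j\<in>{0}. c j)"
    unfolding genfun_vpow by (rule infsum_cong_neutral) (auto simp: vpow_zero)
  then show ?thesis by simp
qed

lemma norm_coeff_vpow_le:
  assumes "u \<in> {0..1}"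
  shows "norm (c j * vpow u j) \<le> norm (c j)"
  using vpow_le_one [OF assms, of j] vpow_nonneg [of u j] assms
  by (simp add: abs_mult mult_left_le)

lemma genfun_has_sum:
  fixes c :: "nat ^ 'n \<Rightarrow> real"
  assumes "c summable_on UNIV" "u \<in> {0..1}"
  shows "((\<lambda>j. c j * vpow u j) has_sum genfun c u) UNIV"
proof -
  have "(\<lambda>j. norm (c j)) summable_on UNIV"
    using assms(1) summable_on_iff_abs_summable_on_real by blast
  then have "(\<lambda>j. norm (c j * vpow u j)) summable_on UNIV"
    by (rule Infinite_Sum.abs_summable_on_comparison_test') (rule norm_coeff_vpow_le [OF assms(2)])
  then show ?thesis
    unfolding genfun_vpow by (intro has_sum_infsum) (rule abs_summable_summable)
qed

text \<open>The coefficients themselves are a summable majorant on the closed cube, so the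
  Weierstrass test gives continuity up to the boundary.\<close>

lemma continuous_on_genfun:
  fixes c :: "nat ^ 'n \<Rightarrow> real"
  assumes "c summable_on UNIV"
  shows "continuous_on {0..1} (genfun c)"
proof (rule uniform_limit_theorem)
  show "uniform_limit {0..1} (\<lambda>X u. \<Sum>j\<in>X. c j * vpow u j) (genfun c) (finite_subsets_at_top UNIV)"
  proof (rule Weierstrass_m_test_general')
    show "(\<lambda>j. norm (c j)) summable_on UNIV"
      using assms summable_on_iff_abs_summable_on_real by blast
  qed (use assms in \<open>auto intro!: norm_coeff_vpow_le [unfolded real_norm_def] genfun_has_sum\<close>)
  show "\<forall>\<^sub>F X in finite_subsets_at_top UNIV. continuous_on {0..1} (\<lambda>u. \<Sum>j\<in>X. c j * vpow u j)"
    unfolding vpow_def by (intro always_eventually allI continuous_intros)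
qed simp

text \<open>Once the term at \<open>d\<close> is taken away, the only one whose coefficient may be
  negative, a power series with nonnegative coefficients remains.\<close>

lemma genfun_mono_except:
  fixes c :: "nat ^ 'n \<Rightarrow> real"
  assumes c: "c summable_on UNIV" "\<And>j. j \<noteq> d \<Longrightarrow> 0 \<le> c j"
    and u: "0 \<le> u" "u \<le> v" "v \<le> 1"
  shows "genfun c u - c d * vpow u d \<le> genfun c v - c d * vpow v d"
proof -
  have *: "((\<lambda>j. c j * vpow u j) has_sum (genfun c u - c d * vpow u d)) (- {d})"
    if "0 \<le> u" "u \<le> 1" for u
  proof -
    have "((\<lambda>j. c j * vpow u j) has_sum (genfun c u - c d * vpow u d)) (UNIV - {d})"
      using c(1) that by (intro has_sum_Diff genfun_has_sum) (auto intro: has_sum_finiteI)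
    then show ?thesis by (simp add: Compl_eq_Diff_UNIV)
  qed
  show ?thesis
    using u c(2) by (intro has_sum_mono [OF * *]) (auto intro!: mult_left_mono vpow_mono)
qed

lemma genfun_eq_infsum_except:
  fixes c :: "nat ^ 'n \<Rightarrow> real"
  assumes "c summable_on (- {d})"
  shows "c summable_on UNIV" "genfun c 1 = c d + (\<Sum>\<^sub>\<infinity>j\<in>- {d}. c j)"
proof -
  have U: "UNIV = insert d (- {d})" by auto
  show "c summable_on UNIV"
    using assms by (subst U) (simp only: summable_on_insert_iff)
  show "genfun c 1 = c d + (\<Sum>\<^sub>\<infinity>j\<in>- {d}. c j)"
    using assms by (subst infsum_insert [symmetric]) (auto simp: genfun_vpow U [symmetric])
qed

text \<open>Adding \<open>i\<close> is a bijection onto \<open>{j. i \<le> j}\<close>. The guard has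
  the same form as in \<open>qmat\<close>.\<close>

lemma has_sum_translate:
  fixes f :: "nat ^ 'n \<Rightarrow> real"
  assumes "(f has_sum S) UNIV"
  shows "((\<lambda>j. if i \<le> j then f (j - i) else 0) has_sum S) UNIV"
proof -
  have "((\<lambda>j. f (j - i)) has_sum S) (range (\<lambda>j. j + i))"
    using assms by (subst has_sum_reindex) (auto simp: o_def inj_on_def)
  also have "range (\<lambda>j. j + i) = {j. i \<le> j}"
  proof (intro set_eqI iffI)
    fix j assume "j \<in> {j. i \<le> j}"
    then have "j = (j - i) + i" by (simp add: vec_eq_iff less_eq_vec_def)
    then show "j \<in> range (\<lambda>j. j + i)" by blast
  qed (auto simp: less_eq_vec_def)
  finally show ?thesis
    by (subst has_sum_cong_neutral [where T = "{j. i \<le> j}"]) auto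
qed

lemma nn_integral_count_space_has_sum:
  fixes f :: "'a \<Rightarrow> real"
  assumes "(f has_sum S) A" "\<And>x. x \<in> A \<Longrightarrow> 0 \<le> f x"
  shows "(\<integral>\<^sup>+ x. ennreal (f x) \<partial>count_space A) = ennreal S"
proof -
  have "Infinite_Set_Sum.abs_summable_on f A"
    using assms(1) has_sum_imp_summable summable_on_iff_abs_summable_on_real abs_summable_equivalent
    by blast
  then show ?thesis
    using assms by (simp add: nn_integral_conv_infsetsum infsetsum_infsum infsumI)
qed

text \<open>Constant factors contribute \<open>ln c / t\<close>, which tends to 0; the constant in
  the lower bound may therefore depend on \<open>e\<close>.\<close>

lemma tendsto_ln_div_at_top:
  fixes f :: "real \<Rightarrow> real"
  assumes upper: "0 < C" "eventually (\<lambda>t. f t \<le> C * exp (r * t)) at_top"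
    and lower: "\<And>e. 0 < e \<Longrightarrow> \<exists>c>0. eventually (\<lambda>t. c * exp ((r - e) * t) \<le> f t) at_top"
  shows "((\<lambda>t. ln (f t) / t) \<longlongrightarrow> r) at_top"
proof -
  have lim: "((\<lambda>t. ln c / t + x) \<longlongrightarrow> x) at_top" for c x :: real
    using tendsto_add [OF tendsto_divide_0 [OF tendsto_const filterlim_at_top_imp_at_infinity [OF filterlim_ident]]
      tendsto_const, of "ln c" x] by simp
  show ?thesis
  proof (rule order_tendstoI)
    fix y assume y: "y < r"
    define e where "e = (r - y) / 2"
    have e: "0 < e" "y < r - e" using y by (auto simp: e_def field_simps)
    obtain c where c: "0 < c" "eventually (\<lambda>t. c * exp ((r - e) * t) \<le> f t) at_top"
      using lower [OF e(1)] by blast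
    have "eventually (\<lambda>t. y < ln c / t + (r - e)) at_top"
      using lim e(2) by (rule order_tendstoD)
    with c(2) eventually_gt_at_top [of 0] show "eventually (\<lambda>t. y < ln (f t) / t) at_top"
    proof eventually_elim
      case (elim t)
      have "ln (c * exp ((r - e) * t)) \<le> ln (f t)"
        using elim c(1) by (subst ln_le_cancel_iff) (auto intro: less_le_trans [rotated])
      then have "(ln c + (r - e) * t) / t \<le> ln (f t) / t"
        using c(1) elim by (intro divide_right_mono) (auto simp: ln_mult)
      moreover have "(ln c + (r - e) * t) / t = ln c / t + (r - e)"
        using elim by (simp add: field_simps)
      ultimately show ?case using elim by linarith
    qed
  next
    fix y assume y: "r < y"
    \<comment> \<open>In this half the lower bound serves to make \<open>f t\<close> positive, so
      that \<open>ln\<close> is monotone there.\<close>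
    obtain c where c: "0 < c" "eventually (\<lambda>t. c * exp ((r - 1) * t) \<le> f t) at_top"
      using lower [of 1] by auto
    have "eventually (\<lambda>t. ln C / t + r < y) at_top"
      using lim y by (rule order_tendstoD)
    with c(2) upper(2) eventually_gt_at_top [of 0] show "eventually (\<lambda>t. ln (f t) / t < y) at_top"
    proof eventually_elim
      case (elim t)
      have "0 < c * exp ((r - 1) * t)" using c(1) by simp
      then have "0 < f t" using elim by linarith
      then have "ln (f t) \<le> ln (C * exp (r * t))"
        using elim upper(1) by (subst ln_le_cancel_iff) auto
      then have "ln (f t) / t \<le> (ln C + r * t) / t"
        using upper(1) elim by (intro divide_right_mono) (auto simp: ln_mult)
      moreover have "(ln C + r * t) / t = ln C / t + r"
        using elim by (simp add: field_simps)
      ultimately show ?case using elim by linarith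
    qed
  qed
qed


section \<open>Branching with immigration\<close>

locale branching_immigration =
  fixes a :: "nat ^ 'n \<Rightarrow> real" and b :: "'n \<Rightarrow> nat ^ 'n \<Rightarrow> real"
  assumes a_nonneg: "\<And>j. j \<noteq> 0 \<Longrightarrow> 0 \<le> a j"
    and a_summable: "a summable_on (- {0})"
    and a_le: "(\<Sum>\<^sub>\<infinity>j\<in>- {0}. a j) \<le> - a 0"
    and b_nonneg: "\<And>k j. j \<noteq> axis k 1 \<Longrightarrow> 0 \<le> b k j"
    and b_summable: "\<And>k. b k summable_on (- {axis k 1})"
    and b_le: "\<And>k. (\<Sum>\<^sub>\<infinity>j\<in>- {axis k 1}. b k j) \<le> - b k (axis k 1)"
begin

section \<open>Rates, generating functions and the action on monomials\<close>

abbreviation "A \<equiv> genfun a"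
abbreviation "B k \<equiv> genfun (b k)"

definition death_rate :: "'n \<Rightarrow> real" where
  "death_rate k = - b k (axis k 1)"

definition generator :: "real ^ 'n \<Rightarrow> nat ^ 'n \<Rightarrow> real" where
  "generator u i = (\<Sum>k\<in>UNIV. real (i $ k) * B k u * vpow u (i - axis k 1)) + A u * vpow u i"

lemma death_rate_nonneg: "0 \<le> death_rate k"
  using b_le [of k] infsum_nonneg [of "- {axis k 1}" "b k"] b_nonneg
  by (fastforce simp: death_rate_def)

lemmas a_summable_UNIV = genfun_eq_infsum_except(1) [OF a_summable]
lemmas b_summable_UNIV = genfun_eq_infsum_except(1) [OF b_summable]

lemma A_one: "A 1 \<le> 0"
  using a_le genfun_eq_infsum_except(2) [OF a_summable] by simp

lemma B_one: "B k 1 \<le> 0"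
  using b_le [of k] genfun_eq_infsum_except(2) [OF b_summable [of k]] by simp

lemma A_mono: "0 \<le> u \<Longrightarrow> u \<le> v \<Longrightarrow> v \<le> 1 \<Longrightarrow> A u \<le> A v"
  using genfun_mono_except [where d = 0, OF a_summable_UNIV a_nonneg, of u v] by simp

lemma A_nonpos: "u \<in> {0..1} \<Longrightarrow> A u \<le> 0"
  using A_mono [of u 1] A_one by simp

lemma A_ge: "u \<in> {0..1} \<Longrightarrow> a 0 \<le> A u"
  using A_mono [of 0 u] by (simp add: genfun_zero)

text \<open>\<open>B k\<close> alone need not be monotone; the linear term cancels its possibly
  negative coefficient, the one at \<open>axis k 1\<close>.\<close>

lemma B_mono:
  "0 \<le> u \<Longrightarrow> u \<le> v \<Longrightarrow> v \<le> 1 \<Longrightarrow> B k u + death_rate k * u $ k \<le> B k v + death_rate k * v $ k"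
  using genfun_mono_except [where d = "axis k 1", OF b_summable_UNIV b_nonneg, of k u v] by (simp add: death_rate_def)

lemma B_le: "u \<in> {0..1} \<Longrightarrow> B k u \<le> death_rate k * (1 - u $ k)"
  using B_mono [of u 1 k] B_one [of k] by (simp add: algebra_simps)

text \<open>Immigration translates \<open>a\<close> by \<open>i\<close>, which gives
  \<open>A u * vpow u i\<close>. Branching replaces one particle of type \<open>k\<close>, so
  \<open>b k\<close> is translated by \<open>i - axis k 1\<close>, with \<open>i $ k\<close>
  particles to choose from.\<close>

lemma has_sum_qmat_vpow:
  assumes u: "u \<in> {0..1}"
  shows "((\<lambda>j. qmat a b i j * vpow u j) has_sum generator u i) UNIV"
proof -
  have imm: "((\<lambda>j. (if i \<le> j then a (j - i) else 0) * vpow u j) has_sum (A u * vpow u i)) UNIV"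
  proof -
    have "((\<lambda>j. vpow u i * (if i \<le> j then a (j - i) * vpow u (j - i) else 0))
        has_sum (vpow u i * A u)) UNIV"
      by (intro has_sum_cmult_right has_sum_translate genfun_has_sum a_summable_UNIV u)
    moreover have "vpow u i * (if i \<le> j then a (j - i) * vpow u (j - i) else 0)
        = (if i \<le> j then a (j - i) else 0) * vpow u j" for j
    proof (cases "i \<le> j")
      case True
      then have "j = i + (j - i)" by (simp add: vec_eq_iff less_eq_vec_def)
      then have "vpow u j = vpow u i * vpow u (j - i)" by (metis vpow_add)
      then show ?thesis by simp
    qed simp
    ultimately show ?thesis by (simp add: mult.commute)
  qed
  have branch: "((\<lambda>j. real (i $ k) * (if i \<le> j + axis k 1 then b k (j + axis k 1 - i) else 0) * vpow u j)
      has_sum (real (i $ k) * B k u * vpow u (i - axis k 1))) UNIV" for k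
  proof (cases "i $ k = 0")
    case False
    \<comment> \<open>With one particle of type \<open>k\<close> removed, the guard
      \<open>i \<le> j + axis k 1\<close> becomes \<open>i' \<le> j\<close>.\<close>
    define i' where "i' = i - axis k 1"
    have i: "i = i' + axis k 1"
      using False by (auto simp: i'_def vec_eq_iff axis_def)
    have "((\<lambda>j. real (i $ k) * vpow u i' * (if i' \<le> j then b k (j - i') * vpow u (j - i') else 0))
        has_sum (real (i $ k) * vpow u i' * B k u)) UNIV"
      by (intro has_sum_cmult_right has_sum_translate genfun_has_sum b_summable_UNIV u)
    moreover have "real (i $ k) * vpow u i' * (if i' \<le> j then b k (j - i') * vpow u (j - i') else 0)
        = real (i $ k) * (if i \<le> j + axis k 1 then b k (j + axis k 1 - i) else 0) * vpow u j" for j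
    proof (cases "i' \<le> j")
      case True
      then have "j = i' + (j - i')" by (simp add: vec_eq_iff less_eq_vec_def)
      then have "vpow u j = vpow u i' * vpow u (j - i')" by (metis vpow_add)
      moreover have "i \<le> j + axis k 1" "j + axis k 1 - i = j - i'"
        using True unfolding i by (auto simp: vec_eq_iff less_eq_vec_def)
      ultimately show ?thesis using True by simp
    next
      case False
      then have "\<not> i \<le> j + axis k 1" unfolding i by (auto simp: less_eq_vec_def)
      then show ?thesis using False by simp
    qed
    ultimately have "((\<lambda>j. real (i $ k) * (if i \<le> j + axis k 1 then b k (j + axis k 1 - i) else 0)
        * vpow u j) has_sum (real (i $ k) * vpow u i' * B k u)) UNIV"
      by simp
    then show ?thesis by (simp add: i'_def mult.commute mult.left_commute)
  qed simp
  have "((\<lambda>j. \<Sum>k\<in>K. real (i $ k) * (if i \<le> j + axis k 1 then b k (j + axis k 1 - i) else 0) * vpow u j)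
      has_sum (\<Sum>k\<in>K. real (i $ k) * B k u * vpow u (i - axis k 1))) UNIV" if "finite K" for K
    using that by (induction K rule: finite_induct) (auto intro!: has_sum_add branch)
  from has_sum_add [OF this [OF finite, of UNIV] imm] show ?thesis
    by (simp add: generator_def qmat_def distrib_right sum_distrib_right)
qed

lemma qmat_off_diagonal: "i \<noteq> j \<Longrightarrow> 0 \<le> qmat a b i j"
proof -
  assume ij: "i \<noteq> j"
  have "0 \<le> b k (j + axis k 1 - i)" if "i \<le> j + axis k 1" for k
  proof (rule b_nonneg)
    show "j + axis k 1 - i \<noteq> axis k 1"
    proof
      assume "j + axis k 1 - i = axis k 1"
      then have "j $ l + axis k 1 $ l - i $ l = axis k 1 $ l" for l
        by (metis vector_add_component vector_minus_component)
      moreover have "i $ l \<le> j $ l + axis k 1 $ l" for l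
        using that by (auto simp: less_eq_vec_def)
      ultimately have "i $ l = j $ l" for l
        by (metis add_diff_cancel_right' diff_diff_cancel)
      then show False using ij by (simp add: vec_eq_iff)
    qed
  qed
  moreover have "0 \<le> a (j - i)" if "i \<le> j"
  proof (rule a_nonneg)
    show "j - i \<noteq> 0"
      using that ij by (auto simp: vec_eq_iff less_eq_vec_def intro: antisym)
  qed
  ultimately show ?thesis
    unfolding qmat_def by (intro add_nonneg_nonneg sum_nonneg mult_nonneg_nonneg) auto
qed

lemma qmat_diagonal: "qmat a b i i = a 0 - (\<Sum>k\<in>UNIV. real (i $ k) * death_rate k)"
  by (simp add: qmat_def death_rate_def less_eq_vec_def sum_negf)

lemma qmat_diagonal_le: "qmat a b i i \<le> a 0"
  unfolding qmat_diagonal using death_rate_nonneg by (simp add: sum_nonneg)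

lemma a_zero_nonpos: "a 0 \<le> 0"
  using A_ge [of 1] A_one by simp

text \<open>Dropping the diagonal term from the row sum leaves nonnegative summands, so the signed
  sum becomes an integral over the counting measure.\<close>

lemma jump_rate_vpow:
  assumes u: "u \<in> {0..1}"
  shows "jump_rate (qmat a b) (\<lambda>j. ennreal (vpow u j)) i
    = ennreal (generator u i - qmat a b i i * vpow u i)"
proof -
  have "((\<lambda>j. qmat a b i j * vpow u j) has_sum (generator u i - qmat a b i i * vpow u i)) (UNIV - {i})"
    by (intro has_sum_Diff has_sum_qmat_vpow u) (auto intro: has_sum_finiteI)
  then have "(\<integral>\<^sup>+ j. ennreal (qmat a b i j * vpow u j) \<partial>count_space (- {i}))
      = ennreal (generator u i - qmat a b i i * vpow u i)"
    using u by (intro nn_integral_count_space_has_sum)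
      (auto simp: Compl_eq_Diff_UNIV qmat_off_diagonal vpow_nonneg)
  then show ?thesis
    using u by (simp add: jump_rate_def ennreal_mult'' vpow_nonneg)
qed

text \<open>At \<open>u = 1\<close> all monomials are 1, so \<open>generator 1 i\<close> is a row
  sum of the matrix; it is nonpositive because \<open>A 1\<close> and every \<open>B k 1\<close>
  are.\<close>

lemma jump_rate_one_le: "jump_rate (qmat a b) (\<lambda>_. 1) i \<le> ennreal (- qmat a b i i)"
proof -
  have "generator 1 i \<le> 0"
    using A_one B_one by (auto simp: generator_def intro!: add_nonpos_nonpos sum_nonpos mult_nonneg_nonpos)
  then show ?thesis
    using jump_rate_vpow [of 1 i] by (auto intro: ennreal_leI)
qed

section \<open>Lower bounds by Euler steps\<close>

abbreviation "W i t \<equiv> feller_limit (qmat a b) i 0 t"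

text \<open>
  If \<open>v' \<le> B(v)\<close> and \<open>u \<le> v\<close>, then \<open>exp (A u * t) * vpow (v t) i\<close> is a subsolution of the backward
  equation; the line \<open>v t = u + t w\<close> is such a path under the condition on \<open>w\<close>.
\<close>

lemma lower_bound_along_line:
  assumes u: "0 \<le> u" and w: "0 \<le> w" "\<And>k. w $ k * (1 + death_rate k * T) \<le> B k u"
    and lt1: "\<And>l. u $ l + T * w $ l < 1"
    and c: "0 < c" and T0: "0 \<le> T\<^sub>0"
    and init: "\<And>i. ennreal (c * vpow u i) \<le> W i T\<^sub>0"
    and t: "t \<in> {0..T}"
  shows "ennreal (c * exp (A u * t) * vpow (u + t *\<^sub>R w) i) \<le> W i (T\<^sub>0 + t)"
proof -
  let ?Q = "qmat a b"
  define v where "v s = u + s *\<^sub>R w" for s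
  define D where "D i s = (\<Sum>k\<in>UNIV. real (i $ k) * w $ k * vpow (v s) (i - axis k 1))" for i s
  define U where "U i s = c * exp (A u * s) * vpow (v s) i" for i s
  define U' where "U' i s = c * exp (A u * s) * (A u * vpow (v s) i + D i s)" for i s
  have v: "v s \<in> {0..1}" "u \<le> v s" "v s \<le> v T" if s: "s \<in> {0..T}" for s
  proof -
    have "s * w $ l \<le> T * w $ l" "0 \<le> s * w $ l" "u $ l + T * w $ l \<le> 1" "0 \<le> u $ l" for l
      using s w u lt1 [of l] by (auto simp: less_eq_vec_def intro: mult_right_mono)
    then show "v s \<in> {0..1}" "u \<le> v s" "v s \<le> v T"
      by (auto simp: v_def less_eq_vec_def; smt (verit))+
  qed
  \<comment> \<open>Along the line \<open>B k\<close> falls by at most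
    \<open>death_rate k * T * w $ k\<close>, and the condition on \<open>w\<close> leaves exactly
    this room.\<close>
  have w_le: "w $ k \<le> B k (v s)" if s: "s \<in> {0..T}" for k s
  proof -
    have "B k u \<le> B k (v s) + death_rate k * (s * w $ k)"
      using B_mono [of u "v s" k] u v [OF s] by (simp add: v_def algebra_simps)
    moreover have "death_rate k * (s * w $ k) \<le> death_rate k * (T * w $ k)"
      using s w death_rate_nonneg by (auto simp: less_eq_vec_def intro!: mult_left_mono mult_right_mono)
    ultimately show ?thesis using w(2) [of k] by (simp add: algebra_simps)
  qed
  have D_nonneg: "0 \<le> D i s" if "s \<in> {0..T}" for i s
    using w(1) v [OF that] unfolding D_def
    by (intro sum_nonneg mult_nonneg_nonneg vpow_nonneg) (auto simp: less_eq_vec_def)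
  have gen: "A u * vpow (v s) i + D i s \<le> generator (v s) i" if s: "s \<in> {0..T}" for i s
  proof -
    have "A u \<le> A (v s)" using u v [OF s] by (intro A_mono) auto
    then show ?thesis
      using v [OF s] w_le [OF s] unfolding generator_def D_def
      by (subst add.commute) (intro add_mono sum_mono mult_right_mono mult_left_mono vpow_nonneg; simp)
  qed
  have u_cube: "u \<in> {0..1}"
    using u v [of 0] t by (simp add: v_def)
  have "ennreal (U i t) \<le> W i (T\<^sub>0 + t)"
  \<comment> \<open>The dominating function is the monomial at the far end \<open>v T\<close>, all
    of whose coordinates are below 1.\<close>
  proof (rule subsolution_le_feller_limit [where U' = U' and Z = "\<lambda>i. c * vpow (v T) i"])
    show "jump_rate ?Q (\<lambda>_. 1) i \<le> ennreal (- ?Q i i)" for i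
      by (rule jump_rate_one_le)
    show "?Q i i \<le> 0" for i
      using qmat_diagonal_le [of i] a_zero_nonpos by linarith
    show "U i \<in> borel_measurable borel" "U' i \<in> borel_measurable borel" for i
      unfolding U_def U'_def D_def v_def vpow_def
      by (intro borel_measurable_continuous_onI continuous_intros)+
    fix i s assume s: "s \<in> {0..T}"
    note v = v [OF s] and D_nonneg = D_nonneg [OF s, of i]
    have vp: "0 \<le> vpow (v s) i" using v by (intro vpow_nonneg) auto
    show "(U i has_real_derivative U' i s) (at s)"
      unfolding U_def U'_def D_def v_def
      by (auto intro!: derivative_eq_intros has_field_derivative_vpow_line simp: algebra_simps)
    show "0 \<le> U i s" using c vp by (simp add: U_def)
    \<comment> \<open>In this grouping both summands are nonnegative, as \<open>a 0\<close> lies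
      between \<open>?Q i i\<close> and \<open>A u\<close>.\<close>
    have "U' i s - ?Q i i * U i s = c * exp (A u * s) * ((A u - ?Q i i) * vpow (v s) i + D i s)"
      by (simp add: U_def U'_def algebra_simps)
    moreover have "0 \<le> A u - ?Q i i"
      using A_ge [OF u_cube] qmat_diagonal_le [of i] by linarith
    ultimately show "0 \<le> U' i s - ?Q i i * U i s"
      using c vp D_nonneg by simp
    have "U' i s - ?Q i i * U i s
        = c * exp (A u * s) * (A u * vpow (v s) i + D i s - ?Q i i * vpow (v s) i)"
      by (simp add: U_def U'_def algebra_simps)
    also have "\<dots> \<le> c * exp (A u * s) * (generator (v s) i - ?Q i i * vpow (v s) i)"
      using gen [OF s, of i] c by (intro mult_left_mono diff_right_mono) auto
    finally have "ennreal (U' i s - ?Q i i * U i s)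
        \<le> ennreal (c * exp (A u * s)) * jump_rate ?Q (\<lambda>j. ennreal (vpow (v s) j)) i"
      unfolding jump_rate_vpow [OF v(1)] using c by (simp add: ennreal_leI ennreal_mult' [symmetric])
    then show "ennreal (U' i s - ?Q i i * U i s) \<le> jump_rate ?Q (\<lambda>k. ennreal (U k s)) i"
      unfolding jump_rate_cmult [symmetric] U_def using c by (simp add: ennreal_mult')
    have "exp (A u * s) \<le> 1"
      using A_nonpos [OF u_cube] s by (simp add: mult_nonpos_nonneg)
    then have "exp (A u * s) * vpow (v s) i \<le> 1 * vpow (v T) i"
      using v vp by (intro mult_mono vpow_mono) auto
    then show "U i s \<le> c * vpow (v T) i"
      using c by (simp add: U_def)
  next
    fix e :: real assume "0 < e"
    have "{i. e < c * vpow (v T) i} = {i. e / c < vpow (v T) i}"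
      using c by (simp add: field_simps)
    also have "finite \<dots>"
    proof (rule finite_vpow_greater)
      show "0 \<le> v T" using v(1) [of T] t by auto
      show "v T $ l < 1" for l using lt1 [of l] by (simp add: v_def)
    qed (use c \<open>0 < e\<close> in simp)
    finally show "finite {i. e < c * vpow (v T) i}" .
  qed (use T0 init t in \<open>auto simp: U_def v_def\<close>)
  then show ?thesis by (simp add: U_def v_def)
qed

text \<open>Strictness makes the monomials vanish at infinity, and \<open>0 \<le> B k u\<close> lets
  the next Euler step go upwards. The constants \<open>c\<close> and \<open>T\<close> must not
  depend on the state \<open>i\<close>.\<close>

definition reached :: "real ^ 'n \<Rightarrow> bool" where
  "reached u \<longleftrightarrow> 0 \<le> u \<and> (\<forall>l. u $ l < 1) \<and> (\<forall>k. 0 \<le> B k u) \<and>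
     (\<exists>c>0. \<exists>T\<ge>0. \<forall>i. ennreal (c * vpow u i) \<le> W i T)"

lemma reached_zero: "reached 0"
proof -
  have "0 \<le> B k 0" for k
    using b_nonneg [of 0 k] by (simp add: genfun_zero axis_eq_0_iff eq_commute [of 0])
  moreover have "ennreal (1 * vpow 0 i) \<le> W i 0" for i
    by (subst feller_limit_renewal) (auto simp: vpow_zero)
  then have "\<exists>T\<ge>0. \<forall>i. ennreal (1 * vpow 0 i) \<le> W i T"
    by blast
  then have "\<exists>c>0. \<exists>T\<ge>0. \<forall>i. ennreal (c * vpow 0 i) \<le> W i T"
    using zero_less_one by blast
  ultimately show ?thesis
    unfolding reached_def by auto
qed

text \<open>Small enough for the condition on \<open>w\<close> in
  \<open>lower_bound_along_line\<close> with \<open>T = 1\<close>; the summand 1 makes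
  \<open>step_size * death_rate k\<close> strictly less than 1.\<close>

definition step_size :: real where
  "step_size = 1 / (1 + (\<Sum>k\<in>UNIV. death_rate k))"

lemma step_size: "0 < step_size" "step_size * (1 + death_rate k) \<le> 1" "step_size * death_rate k < 1"
proof -
  have "death_rate k \<le> (\<Sum>k\<in>UNIV. death_rate k)"
    by (rule member_le_sum) (auto simp: death_rate_nonneg)
  then show "0 < step_size" "step_size * (1 + death_rate k) \<le> 1" "step_size * death_rate k < 1"
    using death_rate_nonneg [of k] by (auto simp: step_size_def field_simps)
qed

definition step :: "real ^ 'n \<Rightarrow> real ^ 'n" where
  "step u = u + step_size *\<^sub>R (\<chi> k. B k u)"

lemma reached_step:
  assumes "reached u"
  shows "reached (step u)" "u \<le> step u"
proof -
  from assms obtain c T where u: "0 \<le> u" "\<And>l. u $ l < 1" "\<And>k. 0 \<le> B k u"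
    and c: "0 < c" "0 \<le> T" "\<And>i. ennreal (c * vpow u i) \<le> W i T"
    by (auto simp: reached_def)
  have u_cube: "u \<in> {0..1}" using u by (auto simp: less_eq_vec_def less_imp_le)
  \<comment> \<open>The step size goes into the velocity, so the line is followed for unit
    time.\<close>
  define w where "w = step_size *\<^sub>R (\<chi> k. B k u)"
  have w_nth: "w $ k = step_size * B k u" for k by (simp add: w_def)
  have step: "step u = u + 1 *\<^sub>R w" by (simp add: step_def w_def)
  have w: "0 \<le> w" using u step_size(1) by (auto simp: less_eq_vec_def w_nth)
  then show le: "u \<le> step u" by (simp add: step)
  \<comment> \<open>By \<open>B_le\<close>, a step covers only a proper fraction of the distance
    \<open>1 - u $ l\<close>.\<close>
  have lt1: "u $ l + 1 * w $ l < 1" for l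
  proof -
    have "w $ l \<le> step_size * (death_rate l * (1 - u $ l))"
      unfolding w_nth using step_size(1) B_le [OF u_cube, of l] by (intro mult_left_mono) auto
    also have "\<dots> = (step_size * death_rate l) * (1 - u $ l)" by simp
    also have "\<dots> < 1 * (1 - u $ l)"
      using step_size(3) [of l] u(2) [of l] by (intro mult_strict_right_mono) auto
    finally show ?thesis by simp
  qed
  have "0 \<le> step u" using u(1) le by (rule order_trans)
  moreover have "step u $ l < 1" for l using lt1 [of l] by (simp add: step)
  moreover have "0 \<le> B k (step u)" for k
  proof -
    have "B k u \<le> B k (step u) + death_rate k * (step u $ k - u $ k)"
      using B_mono [OF u(1) le, of k] lt1 by (auto simp: step less_eq_vec_def less_imp_le algebra_simps)
    moreover have "death_rate k * (step u $ k - u $ k) = (step_size * death_rate k) * B k u"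
      by (simp add: step w_nth)
    moreover have "\<dots> \<le> 1 * B k u"
      using step_size(3) [of k] u(3) [of k] by (intro mult_right_mono) auto
    ultimately show ?thesis by linarith
  qed
  moreover have "\<forall>i. ennreal (c * exp (A u) * vpow (step u) i) \<le> W i (T + 1)"
  proof
    fix i
    have "w $ k * (1 + death_rate k * 1) \<le> B k u" for k
      using mult_right_mono [OF step_size(2) [of k] u(3) [of k]] by (simp add: w_nth mult_ac)
    from lower_bound_along_line [OF u(1) w this lt1 c, of 1 i]
    show "ennreal (c * exp (A u) * vpow (step u) i) \<le> W i (T + 1)"
      by (simp add: step)
  qed
  ultimately show "reached (step u)"
    unfolding reached_def using c
    by (intro conjI exI [of _ "c * exp (A u)"] exI [of _ "T + 1"]) auto
qed

text \<open>The Euler iterates from 0 increase within the cube, and their increments tend to 0, so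
  the limit \<open>L\<close> is a root and lies above \<open>q\<close>. Since \<open>L\<close> may
  have coordinates equal to 1, a late iterate is taken, and continuity of \<open>A\<close> costs
  only \<open>e\<close>.\<close>

lemma ex_reached_near_root:
  assumes q: "minimal_root (\<lambda>k. B k) q" and e: "0 < e"
  shows "\<exists>u. reached u \<and> A q - e < A u"
proof -
  define z where "z m = (step ^^ m) 0" for m
  have reached: "reached (z m)" for m
    by (induction m) (auto simp: z_def reached_zero reached_step)
  have z_Suc: "z (Suc m) = z m + step_size *\<^sub>R (\<chi> k. B k (z m))" for m
    by (simp add: z_def step_def)
  have cube: "z m \<in> {0..1}" for m
    using reached [of m] by (auto simp: reached_def less_eq_vec_def less_imp_le)
  have mono: "z m \<le> z (Suc m)" for m
    using reached_step(2) [OF reached [of m]] by (simp add: z_def)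
  have "\<exists>x. (\<lambda>m. z m $ l) \<longlonglongrightarrow> x" for l
  proof -
    have "incseq (\<lambda>m. z m $ l)" using mono by (auto simp: less_eq_vec_def intro: incseq_SucI)
    moreover have "z m $ l \<le> 1" for m using cube [of m] by (auto simp: less_eq_vec_def)
    ultimately show ?thesis by (metis incseq_convergent)
  qed
  then obtain x where x: "(\<lambda>m. z m $ l) \<longlonglongrightarrow> x l" for l by metis
  define L where "L = vec_lambda x"
  have L: "z \<longlonglongrightarrow> L" using x by (intro vec_tendstoI) (simp add: L_def)
  have L_cube: "L \<in> {0..1}"
  proof -
    have "0 \<le> L $ l \<and> L $ l \<le> 1" for l
    proof -
      have "0 \<le> z m $ l" "z m $ l \<le> 1" for m
        using cube [of m] by (auto simp: less_eq_vec_def)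
      then show ?thesis
        using LIMSEQ_le_const [OF x [of l], of 0] LIMSEQ_le_const2 [OF x [of l], of 1]
        by (auto simp: L_def)
    qed
    then show ?thesis by (auto simp: less_eq_vec_def)
  qed
  have lim: "(\<lambda>m. genfun f (z m)) \<longlonglongrightarrow> genfun f L" if "f summable_on UNIV" for f
    by (rule continuous_on_tendsto_compose [OF continuous_on_genfun [OF that] L L_cube])
       (intro always_eventually allI cube)
  have root: "B k L = 0" for k
  proof -
    have "(\<lambda>m. z (Suc m) $ k - z m $ k) \<longlonglongrightarrow> x k - x k"
      by (intro tendsto_diff x LIMSEQ_Suc)
    moreover have "(\<lambda>m. z (Suc m) $ k - z m $ k) = (\<lambda>m. step_size * B k (z m))"
      by (simp add: z_Suc)
    moreover have "(\<lambda>m. step_size * B k (z m)) \<longlonglongrightarrow> step_size * B k L"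
      by (intro tendsto_mult_left lim b_summable_UNIV)
    ultimately have "step_size * B k L = 0"
      using LIMSEQ_unique by fastforce
    then show ?thesis using step_size(1) by simp
  qed
  have "q \<le> L" "0 \<le> q"
    using q root L_cube by (auto simp: minimal_root_def)
  then have "A q \<le> A L"
    using L_cube by (intro A_mono) auto
  then have "A q - e < A L" using e by linarith
  with lim [OF a_summable_UNIV] have "eventually (\<lambda>m. A q - e < A (z m)) sequentially"
    by (rule order_tendstoD)
  then show ?thesis
    using reached by (auto simp: eventually_sequentially)
qed

lemma return_probability_ge:
  assumes q: "minimal_root (\<lambda>k. B k) q" and e: "0 < e"
  obtains c T where "0 < c" "0 \<le> T"
    "\<And>t. 0 \<le> t \<Longrightarrow> ennreal (c * exp ((A q - e) * t)) \<le> W 0 (T + t)"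
proof -
  from ex_reached_near_root [OF assms] obtain u where u: "reached u" "A q - e < A u"
    by blast
  then obtain c T where c: "0 < c" "0 \<le> T" "\<And>i. ennreal (c * vpow u i) \<le> W i T"
    by (auto simp: reached_def)
  have "ennreal (c * exp ((A q - e) * t)) \<le> W 0 (T + t)" if "0 \<le> t" for t
  proof -
    \<comment> \<open>Velocity 0 keeps the path at \<open>u\<close> for an arbitrarily long time;
      the monomial of state 0 is 1.\<close>
    have "ennreal (c * exp (A u * t) * vpow (u + t *\<^sub>R 0) 0) \<le> W 0 (T + t)"
      using u(1) c that
      by (intro lower_bound_along_line [where T = t]) (auto simp: reached_def)
    moreover have "c * exp ((A q - e) * t) \<le> c * exp (A u * t)"
      using u(2) c that by (intro mult_left_mono) (auto intro: mult_right_mono)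
    ultimately show ?thesis
      by (auto intro: order_trans [OF ennreal_leI])
  qed
  with c(1,2) that show ?thesis by blast
qed

text \<open>Since every \<open>B k q\<close> is 0, the function \<open>vpow q\<close> is an
  eigenfunction of the generator with eigenvalue \<open>A q\<close>, and its value at state 0 is
  1.\<close>

lemma return_probability_le:
  assumes q: "minimal_root (\<lambda>k. B k) q" and "0 \<le> t"
  shows "W 0 t \<le> ennreal (exp (A q * t))"
proof -
  have q': "q \<in> {0..1}" "\<And>k. B k q = 0" using q by (auto simp: minimal_root_def)
  have "W 0 t \<le> ennreal (vpow q 0 * exp (A q * t))"
  proof (rule feller_limit_le_supersolution)
    show "qmat a b i i \<le> A q" for i
      using A_ge [OF q'(1)] qmat_diagonal_le [of i] by linarith
    show "jump_rate (qmat a b) (\<lambda>k. ennreal (vpow q k)) i \<le> ennreal ((A q - qmat a b i i) * vpow q i)" for i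
      unfolding jump_rate_vpow [OF q'(1)] by (simp add: generator_def q'(2) algebra_simps)
  qed (use q' \<open>0 \<le> t\<close> in \<open>auto intro: vpow_nonneg\<close>)
  then show ?thesis by simp
qed

text \<open>The constant 1 is a supersolution with rate 0, as row sums are nonpositive.\<close>

lemma feller_limit_le_one:
  assumes "0 \<le> t"
  shows "feller_limit (qmat a b) i j t \<le> 1"
proof -
  have "feller_limit (qmat a b) i j t \<le> ennreal (1 * exp (0 * t))"
  proof (rule feller_limit_le_supersolution)
    show "qmat a b i i \<le> 0" for i
      using qmat_diagonal_le [of i] a_zero_nonpos by linarith
    show "jump_rate (qmat a b) (\<lambda>k. ennreal 1) i \<le> ennreal ((0 - qmat a b i i) * 1)" for i
      using jump_rate_one_le [of i] by simp
  qed (use assms in simp_all)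
  then show ?thesis by simp
qed

section \<open>Decay rate of the transition probabilities\<close>

lemma ennreal_feller_minimal:
  assumes "0 \<le> t"
  shows "ennreal (feller_minimal (qmat a b) i j t) = feller_limit (qmat a b) i j t"
proof -
  have "feller_limit (qmat a b) i j t < top"
    using feller_limit_le_one [OF assms] by (rule le_less_trans) simp
  then show ?thesis
    by (simp add: feller_minimal_def feller_limit_def [symmetric])
qed

lemma feller_minimal_nonneg: "0 \<le> feller_minimal (qmat a b) i j t"
  by (simp add: feller_minimal_def)

lemma feller_minimal_chapman_kolmogorov:
  assumes "0 \<le> s" "0 \<le> t"
  shows "feller_minimal (qmat a b) i k s * feller_minimal (qmat a b) k j t
    \<le> feller_minimal (qmat a b) i j (s + t)"
proof -
  have "ennreal (feller_minimal (qmat a b) i k s * feller_minimal (qmat a b) k j t)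
      \<le> ennreal (feller_minimal (qmat a b) i j (s + t))"
    using assms feller_limit_chapman_kolmogorov [OF assms, of "qmat a b" i k j]
    by (simp add: ennreal_mult' feller_minimal_nonneg ennreal_feller_minimal)
  then show ?thesis by (simp add: feller_minimal_nonneg)
qed

text \<open>The path 0, \<open>i\<close>, \<open>j\<close>, 0 bounds \<open>p i j\<close> from above
  by the return probability of 0, and the path \<open>i\<close>, 0, 0, \<open>j\<close> bounds it
  from below. The connecting pieces have fixed durations and positive probabilities.\<close>

lemma feller_minimal_decay:
  assumes comm: "communicating_class (feller_minimal (qmat a b)) UNIV"
    and q: "minimal_root (\<lambda>k. B k) q"
  shows "((\<lambda>t. ln (feller_minimal (qmat a b) i j t) / t) \<longlongrightarrow> A q) at_top"
proof -
  define p where "p = feller_minimal (qmat a b)"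
  note p_nonneg = feller_minimal_nonneg [folded p_def]
  note CK = feller_minimal_chapman_kolmogorov [folded p_def]
  obtain x where x: "\<And>i. \<exists>t>0. 0 < p x i t" "\<And>i. \<exists>t>0. 0 < p i x t"
    using comm unfolding communicating_class_def leads_to_def p_def by blast
  have pos: "\<exists>t>0. 0 < p i j t" for i j
  proof -
    obtain s t where "0 < s" "0 < p i x s" "0 < t" "0 < p x j t" using x by metis
    then show ?thesis
      using CK [of s t i x j] by (intro exI [of _ "s + t"]) (auto intro: less_le_trans [rotated])
  qed
  have CK3: "p i k r * p k l t * p l j s \<le> p i j (r + t + s)"
    if "0 \<le> r" "0 \<le> t" "0 \<le> s" for i j k l r s t
  proof -
    have "p i k r * p k l t * p l j s \<le> p i l (r + t) * p l j s"
      using that CK by (intro mult_right_mono p_nonneg) auto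
    also have "\<dots> \<le> p i j (r + t + s)" using that by (intro CK) auto
    finally show ?thesis .
  qed
  obtain r s where rs: "0 < r" "0 < p 0 i r" "0 < s" "0 < p j 0 s" using pos by metis
  obtain r' s' where rs': "0 < r'" "0 < p i 0 r'" "0 < s'" "0 < p 0 j s'" using pos by metis
  have p00_le: "p 0 0 t \<le> exp (A q * t)" if "0 \<le> t" for t
    using return_probability_le [OF q that] that
    by (simp add: ennreal_feller_minimal [symmetric] p_def)
  show ?thesis
    unfolding p_def [symmetric]
  proof (rule tendsto_ln_div_at_top)
    \<comment> \<open>The numerator pays for the extra time \<open>r + s\<close>, the denominator
      for the connecting probabilities.\<close>
    let ?C = "exp (A q * (r + s)) / (p 0 i r * p j 0 s)"
    show "0 < ?C" using rs by simp
    show "eventually (\<lambda>t. p i j t \<le> ?C * exp (A q * t)) at_top"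
      using eventually_ge_at_top [of 0]
    proof eventually_elim
      case (elim t)
      have "p 0 i r * p i j t * p j 0 s \<le> exp (A q * (r + t + s))"
        using CK3 [of r t s 0 i j 0] p00_le [of "r + t + s"] rs elim by linarith
      also have "\<dots> = exp (A q * (r + s)) * exp (A q * t)"
        by (simp add: exp_add [symmetric] algebra_simps)
      finally show ?case using rs by (simp add: field_simps)
    qed
    fix e :: real assume e: "0 < e"
    obtain c T where c: "0 < c" "0 \<le> T"
      "\<And>t. 0 \<le> t \<Longrightarrow> ennreal (c * exp ((A q - e) * t)) \<le> W 0 (T + t)"
      using return_probability_ge [OF q e] by blast
    have p00_ge: "c * exp ((A q - e) * t) \<le> p 0 0 (T + t)" if "0 \<le> t" for t
      using c(3) [OF that] c(2) that
      by (simp add: ennreal_feller_minimal [symmetric] p_def feller_minimal_nonneg)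
    define k where "k = A q - e"
    \<comment> \<open>\<open>R\<close> collects the times of both connecting pieces and the delay
      \<open>T\<close> of the return bound; the factor \<open>exp (- (k * R))\<close> compensates
      for it.\<close>
    define R where "R = r' + T + s'"
    let ?c = "p i 0 r' * p 0 j s' * c * exp (- (k * R))"
    have "eventually (\<lambda>t. ?c * exp ((A q - e) * t) \<le> p i j t) at_top"
      using eventually_ge_at_top [of R]
    proof eventually_elim
      case (elim t)
      define x where "x = t - R"
      have x: "0 \<le> x" "t = r' + (T + x) + s'" using elim by (auto simp: x_def R_def)
      have "exp (k * t) = exp (k * R) * exp (k * x)"
        unfolding exp_add [symmetric] distrib_left [symmetric] by (simp add: x_def)
      then have "?c * exp ((A q - e) * t) = p i 0 r' * (c * exp (k * x)) * p 0 j s'"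
        unfolding k_def [symmetric] by (simp add: exp_minus)
      also have "\<dots> \<le> p i 0 r' * p 0 0 (T + x) * p 0 j s'"
        unfolding k_def by (intro mult_right_mono mult_left_mono p00_ge x(1) p_nonneg)
      also have "\<dots> \<le> p i j t"
        unfolding x(2) by (rule CK3) (use rs' c(2) x(1) in linarith)+
      finally show ?case .
    qed
    moreover have "0 < ?c" using rs' c by simp
    ultimately show "\<exists>c>0. eventually (\<lambda>t. c * exp ((A q - e) * t) \<le> p i j t) at_top"
      by blast
  qed
qed

end

theorem theorem6p2:
  fixes a :: "nat ^ 'n \<Rightarrow> real"
    and b :: "'n \<Rightarrow> nat ^ 'n \<Rightarrow> real"
    and q :: "real ^ 'n"
    and lambda_Z :: real
  assumes a_nonneg: "\<And>j. j \<noteq> 0 \<Longrightarrow> 0 \<le> a j"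
    and a_summable: "a summable_on (- {0})"
    and a_pos: "0 < (\<Sum>\<^sub>\<infinity>j\<in>- {0}. a j)"
    and a_le: "(\<Sum>\<^sub>\<infinity>j\<in>- {0}. a j) \<le> - a 0"
    and b_nonneg: "\<And>k j. j \<noteq> axis k 1 \<Longrightarrow> 0 \<le> b k j"
    and b_summable: "\<And>k. b k summable_on (- {axis k 1})"
    and b_pos: "\<And>k. 0 < (\<Sum>\<^sub>\<infinity>j\<in>- {axis k 1}. b k j)"
    and b_le: "\<And>k. (\<Sum>\<^sub>\<infinity>j\<in>- {axis k 1}. b k j) \<le> - b k (axis k 1)"
    and G_pos_regular: "positively_regular (G_matrix b 1)"
    and B_nonsingular: "nonsingular_family (\<lambda>i. genfun (b i))"
    and B_deriv_finite: "\<And>i j. has_partial (genfun (b i)) j 1"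
    and comm_class: "communicating_class (feller_minimal (qmat a b)) (UNIV :: (nat ^ 'n) set)"
    and q_minimal: "minimal_root (\<lambda>i. genfun (b i)) q"
  shows "is_decay_parameter (feller_minimal (qmat a b)) UNIV lambda_Z \<longleftrightarrow> lambda_Z = - genfun a q"
proof -
  interpret branching_immigration a b
    by unfold_locales (fact a_nonneg a_summable a_le b_nonneg b_summable b_le)+
  note decay = feller_minimal_decay [OF comm_class q_minimal]
  \<comment> \<open>This supplies the condition that a decay parameter is nonnegative; uniqueness of
    limits then fixes its value.\<close>
  have "genfun a q \<le> 0"
    using q_minimal by (intro A_nonpos) (simp add: minimal_root_def)
  moreover have "- lambda_Z = genfun a q"
    if "is_decay_parameter (feller_minimal (qmat a b)) UNIV lambda_Z"
    using that tendsto_unique [OF trivial_limit_at_top_linorder _ decay]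
    by (auto simp: is_decay_parameter_def)
  ultimately show ?thesis
    using decay by (auto simp: is_decay_parameter_def)
qed

end
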